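(* Let $K_1\in\operatorname{End}_{\mathcal A}^*(\mathcal H)$ have closed range, and let $\{\Upsilon_\xi\}_{\xi\in\Omega}$ and $\{\Phi_\xi\}_{\xi\in\Omega}$ be c-$K_1$-g-frames for $\mathcal H$ with respect to $\{\mathcal H_\xi\}_{\xi\in\Omega}$. Assume that $K_2\in\operatorname{End}_{\mathcal A}^*(\mathcal K)$, $\Theta_1,\Theta_2\in\operatorname{End}_{\mathcal A}^*(\mathcal H,\mathcal K)$ and $$\Theta_1\mathcal T_\Upsilon\mathcal T_\Phi^*\Theta_2^*+\Theta_2\mathcal T_\Phi\mathcal T_\Upsilon^*\Theta_1^*\ge0 .$$ Let $\alpha_1,\alpha_2>0$ and consider the following conditions: (i) with $P=\alpha_1\Theta_1+\alpha_2\Theta_2$: $\mathcal R(K_2)\subseteq\mathcal R(P)$ and $\mathcal R(P^* )\subseteq\mathcal R(K_1)$; (ii) with $\mathcal Q=\alpha_1\Theta_1-\alpha_2\Theta_2$: $\mathcal R(\mathcal Q^* )\subseteq\mathcal R(K_1)$, $\mathcal R(K_2)\subseteq\mathcal R(\mathcal Q)$, and $\overline{\mathcal R(\mathcal Q^* )}$ is orthogonally complemented. If one of (i), (ii) holds, then $\{\alpha_1\Upsilon_\xi\Theta_1^*+\alpha_2\Phi_\xi\Theta_2^*\}_{\xi\in\Omega}$ is a c-$K_2$-g-frame for $\mathcal K$ with respect to $\{\mathcal H_\xi\}_{\xi\in\Omega}$.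
   Context: Standing setting: $\mathcal A$ is a unital $C^*$-algebra, $(\Omega,\nu)$ is a measure space, $\mathcal H$ and $\mathcal K$ are Hilbert $\mathcal A$-modules (with $\mathcal A$-valued inner products $\langle\cdot,\cdot\rangle$, linear in the first variable), and $\{\mathcal H_\xi\}_{\xi\in\Omega}$ is a family of (closed sub)modules of $\mathcal K$. $\operatorname{End}_{\mathcal A}^*(\mathcal E,\mathcal F)$ is the set of adjointable $\mathcal A$-linear maps $\mathcal E\to\mathcal F$, and $\operatorname{End}_{\mathcal A}^*(\mathcal E)=\operatorname{End}_{\mathcal A}^*(\mathcal E,\mathcal E)$. $\mathcal R(\cdot)$ denotes range. Inequalities between elements of $\mathcal A$ are in the order of the $C^*$-algebra; $T\ge0$ for an operator means $T$ is positive. For a Hilbert $\mathcal A$-module $\mathcal E$ and $K\in\operatorname{End}_{\mathcal A}^*(\mathcal E)$, a family $\{\Upsilon_\xi\in\operatorname{End}_{\mathcal A}^*(\mathcal E,\mathcal H_\xi)\}_{\xi\in\Omega}$ is a c-$K$-g-frame (continuous $K$-g-frame) for $\mathcal E$ with respect to $\{\mathcal H_\xi\}_{\xi\in\Omega}$ if (a) for every $h\in\mathcal E$ the function $\xi\mapsto\Upsilon_\xi h$ is measurable, and (b) there exist constants $0<A\le B<\infty$ such that for all $h\in\mathcal E$: $A\langle K^*h,K^*h\rangle\le\int_\Omega\langle\Upsilon_\xi h,\Upsilon_\xi h\rangle\,\mathrm d\nu(\xi)\le B\langle h,h\rangle$. $\bigoplus_{\xi\in\Omega}\mathcal H_\xi$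 denotes the Hilbert $\mathcal A$-module of families $\{\alpha_\xi\}$, $\alpha_\xi\in\mathcal H_\xi$, with $\|\int_\Omega\langle\alpha_\xi,\alpha_\xi\rangle\,\mathrm d\nu(\xi)\|<\infty$, with inner product $\langle f,g\rangle=\int_\Omega\langle f_\xi,g_\xi\rangle\,\mathrm d\nu(\xi)$. The synthesis operator of a family $\{\Upsilon_\xi\}$ for $\mathcal H$ satisfying (a) and the right-hand inequality in (b) is $\mathcal T_\Upsilon:\bigoplus_{\xi\in\Omega}\mathcal H_\xi\to\mathcal H$, weakly defined by $\langle\mathcal T_\Upsilon F,g\rangle=\int_\Omega\langle\Upsilon_\xi^*F(\xi),g\rangle\,\mathrm d\nu(\xi)$; its adjoint is given by $(\mathcal T_\Upsilon^*g)(\xi)=\Upsilon_\xi g$. $\mathcal T_\Phi$ is defined in the same way from $\{\Phi_\xi\}$. *)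

theory Defs
  imports "HOL-Analysis.Analysis"
begin

section \<open>Unital C*-algebras and Hilbert C*-modules\<close>

text \<open>The superclasses give completeness and a unit of norm 1, so the zero algebra is excluded.\<close>

class cstar_algebra_1 = real_normed_algebra_1 + banach +
  fixes scaleC :: "complex \<Rightarrow> 'a \<Rightarrow> 'a" (infixr "*\<^sub>C" 75)
    and star :: "'a \<Rightarrow> 'a"
  assumes scaleC_of_real: "complex_of_real r *\<^sub>C x = r *\<^sub>R x"
    and scaleC_add_right: "c *\<^sub>C (x + y) = c *\<^sub>C x + c *\<^sub>C y"
    and scaleC_add_left: "(c + d) *\<^sub>C x = c *\<^sub>C x + d *\<^sub>C x"
    and scaleC_scaleC: "c *\<^sub>C d *\<^sub>C x = (c * d) *\<^sub>C x"
    and scaleC_mult_left: "(c *\<^sub>C x) * y = c *\<^sub>C (x * y)"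
    and scaleC_mult_right: "x * (c *\<^sub>C y) = c *\<^sub>C (x * y)"
    and norm_scaleC: "norm (c *\<^sub>C x) = cmod c * norm x"
    and star_add: "star (x + y) = star x + star y"
    and star_scaleC: "star (c *\<^sub>C x) = cnj c *\<^sub>C star x"
    and star_mult: "star (x * y) = star y * star x"
    and star_star: "star (star x) = x"
    and norm_star_mult_self: "norm (star x * x) = (norm x)\<^sup>2"

definition cstar_pos :: "'a::cstar_algebra_1 \<Rightarrow> bool" where
  "cstar_pos a \<longleftrightarrow> (\<exists>b. a = star b * b)"

definition cstar_le :: "'a::cstar_algebra_1 \<Rightarrow> 'a \<Rightarrow> bool" (infix "\<preceq>" 50) where
  "a \<preceq> b \<longleftrightarrow> cstar_pos (b - a)"

text \<open>
  A Hilbert module is a Banach space type with a left action of the algebra and an inner product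
  that is linear in the first variable and induces the norm. Complex scalars act through the unit
  of the algebra; \<open>act_scaleR\<close> says that the real ones agree with the vector space structure.
\<close>

locale hilbert_module =
  fixes act :: "'a::cstar_algebra_1 \<Rightarrow> 'e::banach \<Rightarrow> 'e"
    and ip :: "'e \<Rightarrow> 'e \<Rightarrow> 'a"
  assumes act_add_right: "act a (x + y) = act a x + act a y"
    and act_add_left: "act (a + b) x = act a x + act b x"
    and act_mult: "act (a * b) x = act a (act b x)"
    and act_one: "act 1 x = x"
    and act_scaleR: "act (r *\<^sub>R 1) x = r *\<^sub>R x"
    and ip_add_left: "ip (x + y) z = ip x z + ip y z"
    and ip_act_left: "ip (act a x) y = a * ip x y"
    and ip_star: "ip y x = star (ip x y)"
    and ip_pos: "cstar_pos (ip x x)"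
    and ip_definite: "ip x x = 0 \<Longrightarrow> x = 0"
    and norm_eq_ip: "norm x = sqrt (norm (ip x x))"

definition closed_submodule :: "('a \<Rightarrow> 'e \<Rightarrow> 'e) \<Rightarrow> 'e::real_normed_vector set \<Rightarrow> bool" where
  "closed_submodule act S \<longleftrightarrow> closed S \<and> subspace S \<and> (\<forall>a. \<forall>x\<in>S. act a x \<in> S)"

definition orthogonally_complemented :: "('e \<Rightarrow> 'e \<Rightarrow> 'a::zero) \<Rightarrow> 'e::plus set \<Rightarrow> bool" where
  "orthogonally_complemented ip S \<longleftrightarrow>
     (\<forall>x. \<exists>y\<in>S. \<exists>z. (\<forall>s\<in>S. ip s z = 0) \<and> x = y + z)"


section \<open>Adjointable maps\<close>

text \<open>
  Domain and codomain are sets carrying an inner product, so that the same notion serves the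
  modules themselves, the submodules, and the direct sum below.
\<close>

definition adjoint_pair ::
    "'e set \<Rightarrow> ('e \<Rightarrow> 'e \<Rightarrow> 'a) \<Rightarrow> 'f set \<Rightarrow> ('f \<Rightarrow> 'f \<Rightarrow> 'a) \<Rightarrow> ('e \<Rightarrow> 'f) \<Rightarrow> ('f \<Rightarrow> 'e) \<Rightarrow> bool" where
  "adjoint_pair E ipE F ipF T S \<longleftrightarrow>
     (\<forall>x\<in>E. T x \<in> F) \<and> (\<forall>y\<in>F. S y \<in> E) \<and> (\<forall>x\<in>E. \<forall>y\<in>F. ipF (T x) y = ipE x (S y))"

text \<open>Linearity over the algebra is automatic, see \<open>End_adj_linear\<close> below.\<close>

definition End_adj ::
    "'e set \<Rightarrow> ('e \<Rightarrow> 'e \<Rightarrow> 'a) \<Rightarrow> 'f set \<Rightarrow> ('f \<Rightarrow> 'f \<Rightarrow> 'a) \<Rightarrow> ('e \<Rightarrow> 'f) set" where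
  "End_adj E ipE F ipF = {T. \<exists>S. adjoint_pair E ipE F ipF T S}"

definition adj :: "('e \<Rightarrow> 'e \<Rightarrow> 'a) \<Rightarrow> ('f \<Rightarrow> 'f \<Rightarrow> 'a) \<Rightarrow> ('e \<Rightarrow> 'f) \<Rightarrow> 'f \<Rightarrow> 'e" where
  "adj ipE ipF T y = (THE x. \<forall>z. ipF (T z) y = ipE z x)"

definition positive_op :: "('e \<Rightarrow> 'e \<Rightarrow> 'a::cstar_algebra_1) \<Rightarrow> ('e \<Rightarrow> 'e) \<Rightarrow> bool" where
  "positive_op ip T \<longleftrightarrow> T \<in> End_adj UNIV ip UNIV ip \<and> (\<forall>x. cstar_pos (ip (T x) x))"

context hilbert_module
begin

lemma ip_diff_left: "ip (x - y) z = ip x z - ip y z"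
  using ip_add_left[of "x - y" y z] by (simp add: algebra_simps)

lemma ip_add_right: "ip z (x + y) = ip z x + ip z y"
  using ip_star[of z "x + y"] ip_star[of z x] ip_star[of z y] by (simp only: ip_add_left star_add)

lemma ip_diff_right: "ip z (x - y) = ip z x - ip z y"
  using ip_add_right[of z "x - y" y] by (simp add: algebra_simps)

lemma ip_eqI:
  assumes "\<And>z. ip z x = ip z y"
  shows "x = y"
proof -
  have "ip (x - y) (x - y) = 0"
    using assms[of "x - y"] by (simp add: ip_diff_right)
  then show ?thesis
    using ip_definite by fastforce
qed

end

lemma End_adj_linear:
  assumes "hilbert_module actE ipE" "hilbert_module actF ipF"
    and E: "closed_submodule actE E" and F: "closed_submodule actF F"
    and T: "T \<in> End_adj E ipE F ipF" and x: "x \<in> E" and y: "y \<in> E"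
  shows "T (actE a x + y) = actF a (T x) + T y"
proof -
  interpret E: hilbert_module actE ipE by fact
  interpret F: hilbert_module actF ipF by fact
  obtain S where S: "adjoint_pair E ipE F ipF T S"
    using T by (auto simp: End_adj_def)
  let ?d = "T (actE a x + y) - (actF a (T x) + T y)"
  have xy: "actE a x + y \<in> E"
    using E x y by (auto simp: closed_submodule_def intro: subspace_add)
  have "?d \<in> F"
    using S F x y xy by (auto simp: closed_submodule_def adjoint_pair_def intro!: subspace_add subspace_diff)
  then have "ipF ?d ?d = 0"
    using S x y xy
    by (simp only: F.ip_diff_left F.ip_add_left F.ip_act_left)
       (simp add: adjoint_pair_def E.ip_add_left E.ip_act_left)
  then show ?thesis
    using F.ip_definite by fastforce
qed

lemma adj_eq:
  assumes "hilbert_module actE ipE" and S: "adjoint_pair UNIV ipE F ipF T S" and y: "y \<in> F"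
  shows "adj ipE ipF T y = S y"
proof -
  interpret hilbert_module actE ipE by fact
  have "\<forall>z. ipF (T z) y = ipE z (S y)"
    using S y by (simp add: adjoint_pair_def)
  then show ?thesis
    unfolding adj_def by (intro the_equality) (auto intro: ip_eqI)
qed


section \<open>Bochner integration without separability\<close>

text \<open>
  The library's \<open>has_bochner_integral\<close> requires a second countable space. These are its defining
  clauses with Borel measurability replaced by strong measurability (pointwise approximability
  by simple functions), which is the same thing for separable spaces.
\<close>

definition strongly_measurable :: "'w measure \<Rightarrow> ('w \<Rightarrow> 'b::real_normed_vector) \<Rightarrow> bool" where
  "strongly_measurable M f \<longleftrightarrow>
     (\<exists>s. (\<forall>i. simple_function M (s i)) \<and> (\<forall>x\<in>space M. (\<lambda>i::nat. s i x) \<longlonglongrightarrow> f x))"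

definition has_strong_integral :: "'w measure \<Rightarrow> ('w \<Rightarrow> 'b::real_normed_vector) \<Rightarrow> 'b \<Rightarrow> bool" where
  "has_strong_integral M f I \<longleftrightarrow>
     strongly_measurable M f \<and>
     (\<exists>s. (\<forall>i. Bochner_Integration.simple_bochner_integrable M (s i)) \<and>
          (\<lambda>i::nat. \<integral>\<^sup>+x. ennreal (norm (f x - s i x)) \<partial>M) \<longlonglongrightarrow> 0 \<and>
          (\<lambda>i. Bochner_Integration.simple_bochner_integral M (s i)) \<longlonglongrightarrow> I)"

definition strongly_integrable :: "'w measure \<Rightarrow> ('w \<Rightarrow> 'b::real_normed_vector) \<Rightarrow> bool" where
  "strongly_integrable M f \<longleftrightarrow> (\<exists>I. has_strong_integral M f I)"

definition strong_integral :: "'w measure \<Rightarrow> ('w \<Rightarrow> 'b::real_normed_vector) \<Rightarrow> 'b" where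
  "strong_integral M f = (THE I. has_strong_integral M f I)"

lemma strongly_measurable_cong:
  "(\<And>x. x \<in> space M \<Longrightarrow> f x = g x) \<Longrightarrow> strongly_measurable M f \<longleftrightarrow> strongly_measurable M g"
  by (simp add: strongly_measurable_def)

lemma has_strong_integral_cong:
  assumes "\<And>x. x \<in> space M \<Longrightarrow> f x = g x"
  shows "has_strong_integral M f I \<longleftrightarrow> has_strong_integral M g I"
proof -
  have "(\<integral>\<^sup>+x. ennreal (norm (f x - s x)) \<partial>M) = (\<integral>\<^sup>+x. ennreal (norm (g x - s x)) \<partial>M)" for s
    by (intro nn_integral_cong) (simp add: assms)
  then show ?thesis
    using strongly_measurable_cong[of M f g] assms by (simp add: has_strong_integral_def)
qed

lemma strong_measurable_diff_norm:
  fixes f :: "'w \<Rightarrow> 'b::real_normed_vector"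
  assumes f: "strongly_measurable M f" and t: "simple_function M t"
  shows "(\<lambda>x. norm (f x - t x)) \<in> borel_measurable M"
proof -
  obtain s where s: "\<And>i. simple_function M (s i)"
      "\<And>x. x \<in> space M \<Longrightarrow> (\<lambda>i::nat. s i x) \<longlonglongrightarrow> f x"
    using f by (auto simp: strongly_measurable_def)
  show ?thesis
  proof (rule borel_measurable_LIMSEQ_real)
    show "(\<lambda>i. norm (s i x - t x)) \<longlonglongrightarrow> norm (f x - t x)" if "x \<in> space M" for x
      using s(2)[OF that] by (intro tendsto_intros)
    show "(\<lambda>x. norm (s i x - t x)) \<in> borel_measurable M" for i
      using simple_function_compose2[OF s(1) t, of "\<lambda>a b. norm (a - b)"]
      by (intro borel_measurable_simple_function) simp
  qed
qed

lemma has_strong_integral_unique: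
  assumes "has_strong_integral M f I" "has_strong_integral M f J"
  shows "I = J"
proof -
  obtain s where s: "\<And>i. Bochner_Integration.simple_bochner_integrable M (s i)"
      "(\<lambda>i::nat. \<integral>\<^sup>+x. ennreal (norm (f x - s i x)) \<partial>M) \<longlonglongrightarrow> 0"
      "(\<lambda>i. Bochner_Integration.simple_bochner_integral M (s i)) \<longlonglongrightarrow> I"
    and f: "strongly_measurable M f"
    using assms(1) by (auto simp: has_strong_integral_def)
  obtain t where t: "\<And>i. Bochner_Integration.simple_bochner_integrable M (t i)"
      "(\<lambda>i::nat. \<integral>\<^sup>+x. ennreal (norm (f x - t i x)) \<partial>M) \<longlonglongrightarrow> 0"
      "(\<lambda>i. Bochner_Integration.simple_bochner_integral M (t i)) \<longlonglongrightarrow> J"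
    using assms(2) by (auto simp: has_strong_integral_def)
  have sf: "simple_function M (s i)" "simple_function M (t i)" for i
    using s(1) t(1) by (auto elim: simple_bochner_integrable.cases)
  have "(\<lambda>i. ennreal (norm (Bochner_Integration.simple_bochner_integral M (s i) - Bochner_Integration.simple_bochner_integral M (t i))))
          \<longlonglongrightarrow> 0 + 0"
  proof (rule tendsto_sandwich[OF _ _ tendsto_const tendsto_add[OF s(2) t(2)]])
    show "\<forall>\<^sub>F i in sequentially.
        ennreal (norm (Bochner_Integration.simple_bochner_integral M (s i) - Bochner_Integration.simple_bochner_integral M (t i)))
        \<le> (\<integral>\<^sup>+x. ennreal (norm (f x - s i x)) \<partial>M) + (\<integral>\<^sup>+x. ennreal (norm (f x - t i x)) \<partial>M)"
    proof (intro always_eventually allI)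
      fix i
      have d: "Bochner_Integration.simple_bochner_integrable M (\<lambda>x. s i x - t i x)"
        using simple_bochner_integrable_compose2[of "(-)" M "s i" "t i"] s(1) t(1) by simp
      have "ennreal (norm (Bochner_Integration.simple_bochner_integral M (s i) - Bochner_Integration.simple_bochner_integral M (t i)))
          = ennreal (norm (Bochner_Integration.simple_bochner_integral M (\<lambda>x. s i x - t i x)))"
        using simple_bochner_integral_diff[OF s(1) t(1)] by simp
      also have "\<dots> \<le> ennreal (Bochner_Integration.simple_bochner_integral M (\<lambda>x. norm (s i x - t i x)))"
        by (intro ennreal_leI simple_bochner_integral_norm_bound d)
      also have "\<dots> = (\<integral>\<^sup>+x. norm (s i x - t i x) \<partial>M)"
        using simple_bochner_integrable_compose2[of "\<lambda>x y. norm (x - y)" M "s i" "t i"] s(1) t(1)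
        by (intro simple_bochner_integral_eq_nn_integral) auto
      also have "\<dots> \<le> (\<integral>\<^sup>+x. ennreal (norm (f x - s i x)) + ennreal (norm (f x - t i x)) \<partial>M)"
      proof (rule nn_integral_mono)
        fix x
        have "norm (s i x - t i x) \<le> norm (f x - s i x) + norm (f x - t i x)"
          using norm_triangle_ineq4[of "f x - t i x" "f x - s i x"] by simp
        then show "ennreal (norm (s i x - t i x))
            \<le> ennreal (norm (f x - s i x)) + ennreal (norm (f x - t i x))"
          by (simp add: ennreal_leI flip: ennreal_plus)
      qed
      also have "\<dots> = (\<integral>\<^sup>+x. ennreal (norm (f x - s i x)) \<partial>M)
          + (\<integral>\<^sup>+x. ennreal (norm (f x - t i x)) \<partial>M)"
        using strong_measurable_diff_norm[OF f sf(1)] strong_measurable_diff_norm[OF f sf(2)]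
        by (intro nn_integral_add) auto
      finally show "ennreal (norm (Bochner_Integration.simple_bochner_integral M (s i) - Bochner_Integration.simple_bochner_integral M (t i)))
        \<le> (\<integral>\<^sup>+x. ennreal (norm (f x - s i x)) \<partial>M) + (\<integral>\<^sup>+x. ennreal (norm (f x - t i x)) \<partial>M)" .
    qed
  qed simp
  then have "(\<lambda>i. norm (Bochner_Integration.simple_bochner_integral M (s i) - Bochner_Integration.simple_bochner_integral M (t i))) \<longlonglongrightarrow> 0"
    using ennreal_tendsto_0_iff by simp
  then have "(\<lambda>i. Bochner_Integration.simple_bochner_integral M (s i) - Bochner_Integration.simple_bochner_integral M (t i)) \<longlonglongrightarrow> 0"
    by (simp add: tendsto_norm_zero_iff)
  moreover have "(\<lambda>i. Bochner_Integration.simple_bochner_integral M (s i) - Bochner_Integration.simple_bochner_integral M (t i)) \<longlonglongrightarrow> I - J"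
    by (intro tendsto_intros s t)
  ultimately show ?thesis
    using LIMSEQ_unique by fastforce
qed

lemma strong_integral_eqI: "has_strong_integral M f I \<Longrightarrow> strong_integral M f = I"
  unfolding strong_integral_def by (intro the_equality) (auto intro: has_strong_integral_unique)


section \<open>Continuous K-g-frames and synthesis operators\<close>

text \<open>
  \<open>\<Upsilon> \<xi>\<close> maps the module with inner product \<open>ipE\<close> into the submodule \<open>Hs \<xi>\<close> of the module with
  inner product \<open>ipK\<close>.
\<close>

definition g_family ::
    "'w measure \<Rightarrow> ('e \<Rightarrow> 'e \<Rightarrow> 'a) \<Rightarrow> ('w \<Rightarrow> 'k set) \<Rightarrow> ('k::real_normed_vector \<Rightarrow> 'k \<Rightarrow> 'a)
      \<Rightarrow> ('w \<Rightarrow> 'e \<Rightarrow> 'k) \<Rightarrow> bool" where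
  "g_family M ipE Hs ipK \<Upsilon> \<longleftrightarrow>
     (\<forall>\<xi>\<in>space M. \<Upsilon> \<xi> \<in> End_adj UNIV ipE (Hs \<xi>) ipK) \<and>
     (\<forall>h. strongly_measurable M (\<lambda>\<xi>. \<Upsilon> \<xi> h))"

definition cKg_frame ::
    "'w measure \<Rightarrow> ('e \<Rightarrow> 'e \<Rightarrow> 'a::cstar_algebra_1) \<Rightarrow> ('e \<Rightarrow> 'e) \<Rightarrow> ('w \<Rightarrow> 'k set)
      \<Rightarrow> ('k::real_normed_vector \<Rightarrow> 'k \<Rightarrow> 'a) \<Rightarrow> ('w \<Rightarrow> 'e \<Rightarrow> 'k) \<Rightarrow> bool" where
  "cKg_frame M ipE K Hs ipK \<Upsilon> \<longleftrightarrow>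
     g_family M ipE Hs ipK \<Upsilon> \<and>
     (\<exists>A B. 0 < A \<and> A \<le> B \<and>
        (\<forall>h. strongly_integrable M (\<lambda>\<xi>. ipK (\<Upsilon> \<xi> h) (\<Upsilon> \<xi> h)) \<and>
             A *\<^sub>R ipE (adj ipE ipE K h) (adj ipE ipE K h)
               \<preceq> strong_integral M (\<lambda>\<xi>. ipK (\<Upsilon> \<xi> h) (\<Upsilon> \<xi> h)) \<and>
             strong_integral M (\<lambda>\<xi>. ipK (\<Upsilon> \<xi> h) (\<Upsilon> \<xi> h)) \<preceq> B *\<^sub>R ipE h h))"

text \<open>The direct sum of the \<open>Hs \<xi>\<close>; its elements are represented by functions, not by
  classes of almost everywhere equal functions.\<close>

definition direct_sum ::
    "'w measure \<Rightarrow> ('w \<Rightarrow> 'k set) \<Rightarrow> ('k \<Rightarrow> 'k \<Rightarrow> 'a::real_normed_vector)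
      \<Rightarrow> ('w \<Rightarrow> 'k::real_normed_vector) set" where
  "direct_sum M Hs ipK = {F. (\<forall>\<xi>\<in>space M. F \<xi> \<in> Hs \<xi>) \<and> strongly_measurable M F \<and>
     strongly_integrable M (\<lambda>\<xi>. ipK (F \<xi>) (F \<xi>))}"

definition direct_sum_ip ::
    "'w measure \<Rightarrow> ('k \<Rightarrow> 'k \<Rightarrow> 'a::real_normed_vector) \<Rightarrow> ('w \<Rightarrow> 'k) \<Rightarrow> ('w \<Rightarrow> 'k) \<Rightarrow> 'a" where
  "direct_sum_ip M ipK F G = strong_integral M (\<lambda>\<xi>. ipK (F \<xi>) (G \<xi>))"

text \<open>\<open>T\<close> is the synthesis operator of \<open>\<Upsilon>\<close>: on the direct sum it satisfies the weak definition,
  which determines \<open>T F\<close> uniquely. (Existence is part of the predicate: a Hilbert module need not be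
  self-dual, so it does not follow from the frame inequalities in the nonseparable case.)\<close>

definition synthesis_operator ::
    "'w measure \<Rightarrow> ('e \<Rightarrow> 'e \<Rightarrow> 'a::real_normed_vector) \<Rightarrow> ('w \<Rightarrow> 'k set)
      \<Rightarrow> ('k::real_normed_vector \<Rightarrow> 'k \<Rightarrow> 'a) \<Rightarrow> ('w \<Rightarrow> 'e \<Rightarrow> 'k) \<Rightarrow> (('w \<Rightarrow> 'k) \<Rightarrow> 'e) \<Rightarrow> bool" where
  "synthesis_operator M ipE Hs ipK \<Upsilon> T \<longleftrightarrow>
     (\<forall>F\<in>direct_sum M Hs ipK. \<forall>g.
        has_strong_integral M (\<lambda>\<xi>. ipE (adj ipE ipK (\<Upsilon> \<xi>) (F \<xi>)) g) (ipE (T F) g))"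

text \<open>The adjoint of the synthesis operator, see \<open>adjoint_pair_synthesis_analysis\<close>.\<close>

definition analysis :: "('w \<Rightarrow> 'e \<Rightarrow> 'k) \<Rightarrow> 'e \<Rightarrow> 'w \<Rightarrow> 'k" where
  "analysis \<Upsilon> g = (\<lambda>\<xi>. \<Upsilon> \<xi> g)"

lemma synthesis_operator_unique:
  assumes "hilbert_module actE ipE" "synthesis_operator M ipE Hs ipK \<Upsilon> T"
    "synthesis_operator M ipE Hs ipK \<Upsilon> T'" "F \<in> direct_sum M Hs ipK"
  shows "T F = T' F"
proof -
  interpret hilbert_module actE ipE by fact
  have "ipE (T F) g = ipE (T' F) g" for g
    using assms(2-4) unfolding synthesis_operator_def by (blast intro: has_strong_integral_unique)
  then show ?thesis
    using ip_star[of _ "T F"] ip_star[of _ "T' F"] by (intro ip_eqI) (simp only:)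
qed

lemma adjoint_pair_synthesis_analysis:
  assumes E: "hilbert_module actE ipE" and K: "hilbert_module actK ipK"
    and frame: "cKg_frame M ipE K0 Hs ipK \<Upsilon>"
    and T: "synthesis_operator M ipE Hs ipK \<Upsilon> T"
  shows "adjoint_pair (direct_sum M Hs ipK) (direct_sum_ip M ipK) UNIV ipE T (analysis \<Upsilon>)"
proof -
  interpret E: hilbert_module actE ipE by fact
  interpret K: hilbert_module actK ipK by fact
  have adj: "\<forall>\<xi>\<in>space M. \<exists>S. adjoint_pair UNIV ipE (Hs \<xi>) ipK (\<Upsilon> \<xi>) S"
    using frame by (auto simp: cKg_frame_def g_family_def End_adj_def)
  have "analysis \<Upsilon> g \<in> direct_sum M Hs ipK" for g
  proof -
    have "\<Upsilon> \<xi> g \<in> Hs \<xi>" if "\<xi> \<in> space M" for \<xi>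
      using adj that by (auto simp: adjoint_pair_def)
    moreover have "strongly_measurable M (\<lambda>\<xi>. \<Upsilon> \<xi> g)"
      using frame by (simp add: cKg_frame_def g_family_def)
    moreover have "strongly_integrable M (\<lambda>\<xi>. ipK (\<Upsilon> \<xi> g) (\<Upsilon> \<xi> g))"
      using frame unfolding cKg_frame_def by (elim conjE exE) simp
    ultimately show ?thesis
      by (simp add: direct_sum_def analysis_def)
  qed
  moreover have "ipE (T F) g = direct_sum_ip M ipK F (analysis \<Upsilon> g)" if F: "F \<in> direct_sum M Hs ipK" for F g
  proof -
    have "ipE (adj ipE ipK (\<Upsilon> \<xi>) (F \<xi>)) g = ipK (F \<xi>) (\<Upsilon> \<xi> g)" if \<xi>: "\<xi> \<in> space M" for \<xi>
    proof -
      obtain S where S: "adjoint_pair UNIV ipE (Hs \<xi>) ipK (\<Upsilon> \<xi>) S"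
        using bspec[OF adj \<xi>] by (elim exE)
      have F\<xi>: "F \<xi> \<in> Hs \<xi>"
        using F that by (simp add: direct_sum_def)
      have "adj ipE ipK (\<Upsilon> \<xi>) (F \<xi>) = S (F \<xi>)"
        by (rule adj_eq[OF E S F\<xi>])
      moreover have "ipK (\<Upsilon> \<xi> g) (F \<xi>) = ipE g (S (F \<xi>))"
        using S F\<xi> by (simp add: adjoint_pair_def)
      ultimately show ?thesis
        using E.ip_star[of "S (F \<xi>)" g] K.ip_star[of "F \<xi>" "\<Upsilon> \<xi> g"] by (simp only:)
    qed
    then have "has_strong_integral M (\<lambda>\<xi>. ipE (adj ipE ipK (\<Upsilon> \<xi>) (F \<xi>)) g) I
        \<longleftrightarrow> has_strong_integral M (\<lambda>\<xi>. ipK (F \<xi>) (\<Upsilon> \<xi> g)) I" for I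
      by (rule has_strong_integral_cong)
    moreover have "has_strong_integral M (\<lambda>\<xi>. ipE (adj ipE ipK (\<Upsilon> \<xi>) (F \<xi>)) g) (ipE (T F) g)"
      using spec[OF bspec[OF T[unfolded synthesis_operator_def] F]] .
    ultimately have "has_strong_integral M (\<lambda>\<xi>. ipK (F \<xi>) (\<Upsilon> \<xi> g)) (ipE (T F) g)"
      by (rule iffD1)
    then show ?thesis
      by (simp add: direct_sum_ip_def analysis_def strong_integral_eqI)
  qed
  ultimately show ?thesis
    by (simp add: adjoint_pair_def)
qed

end

theory Submission
  imports Defs
begin

text \<open>
  Write \<open>u = \<Theta>1\<^sup>* x\<close> and \<open>v = \<Theta>2\<^sup>* x\<close>. The cross terms in the integral of
  \<open>\<langle>\<alpha>1 \<Upsilon>\<^sub>\<xi> u + \<alpha>2 \<Phi>\<^sub>\<xi> v, \<alpha>1 \<Upsilon>\<^sub>\<xi> u + \<alpha>2 \<Phi>\<^sub>\<xi> v\<rangle>\<close> add up to the quadratic form of the operator that is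
  assumed positive. Dropping them and using the lower frame bounds and the parallelogram law leaves
  a multiple of \<open>\<langle>K1\<^sup>* W\<^sup>* x, K1\<^sup>* W\<^sup>* x\<rangle>\<close>, where \<open>W\<close> is \<open>P\<close> or \<open>Q\<close>. The closed range theorem for \<open>K1\<close>
  and the inclusion of ranges bound \<open>\<parallel>K2\<^sup>* x\<parallel>\<close> by a multiple of \<open>\<parallel>K1\<^sup>* W\<^sup>* x\<parallel>\<close>. Since all maps are
  linear over the algebra, replacing \<open>x\<close> by \<open>a x\<close> with \<open>a = (\<langle>K1\<^sup>* W\<^sup>* x, K1\<^sup>* W\<^sup>* x\<rangle> + \<epsilon>)\<^sup>-\<^sup>1\<^sup>/\<^sup>2\<close> turns this
  norm inequality into one in the order of the algebra. The upper bound is obtained in the same way.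
\<close>

section \<open>Positive elements of a C*-algebra\<close>

lemma star_one [simp]: "star (1::'a::cstar_algebra_1) = 1"
  using star_mult[of "star 1" "1::'a"] by (simp add: star_star)

lemma star_scaleR [simp]: "star (r *\<^sub>R x) = r *\<^sub>R star (x::'a::cstar_algebra_1)"
  using star_scaleC[of "complex_of_real r" x] by (simp add: scaleC_of_real)

lemma linear_star: "linear (star :: 'a \<Rightarrow> 'a::cstar_algebra_1)"
  by (rule linearI) (simp_all add: star_add)

lemmas star_linear [simp] =
  linear_0[OF linear_star] linear_neg[OF linear_star] linear_diff[OF linear_star] star_add star_star

text \<open>The C*-identity gives \<open>(norm y)\<^sup>2 \<le> norm (star y) * norm y\<close>.
  Cancelling, and applying this to \<open>x\<close> and to \<open>star x\<close>, gives both
  inequalities.\<close>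

lemma norm_star [simp]: "norm (star x) = norm (x::'a::cstar_algebra_1)"
proof -
  have le: "norm y \<le> norm (star y)" for y :: 'a
  proof (cases "y = 0")
    case False
    have "norm y * norm y \<le> norm (star y) * norm y"
      using norm_mult_ineq[of "star y" y] by (simp add: norm_star_mult_self flip: power2_eq_square)
    then show ?thesis
      using False by simp
  qed simp
  show ?thesis
    using le[of x] le[of "star x"] by simp
qed

lemma tendsto_star:
  fixes f :: "_ \<Rightarrow> 'a::cstar_algebra_1"
  assumes "(f \<longlongrightarrow> a) F"
  shows "((\<lambda>x. star (f x)) \<longlongrightarrow> star a) F"
proof -
  have "bounded_linear (star :: 'a \<Rightarrow> 'a)"
    using linear_star by (auto simp: linear_conv_bounded_linear intro: bounded_linear_intro[where K=1])
  then show ?thesis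
    using assms by (rule bounded_linear.tendsto)
qed

lemma norm_mult_selfadjoint: "star s = s \<Longrightarrow> norm (s * s) = (norm (s::'a::cstar_algebra_1))\<^sup>2"
  using norm_star_mult_self[of s] by simp

text \<open>Writing \<open>s = 1 - y\<close>, the equation \<open>s\<^sup>2 = 1 - x\<close> becomes \<open>y = (x + y\<^sup>2) / 2\<close>. The iteration of this
  map from \<open>0\<close> is dominated by the same iteration for the number \<open>x = 1\<close>, which increases and is
  bounded by \<open>1\<close>.\<close>

lemma selfadjoint_sqrt_unit:
  fixes x :: "'a::cstar_algebra_1"
  assumes sa: "star x = x" and x: "norm x \<le> 1"
  obtains s where "star s = s" "norm (1 - s) \<le> 1" "s * s = 1 - x"
    "\<And>z. z * x = x * z \<Longrightarrow> z * s = s * z"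
proof -
  define y where "y n = ((\<lambda>u. (1/2) *\<^sub>R (x + u * u)) ^^ n) 0" for n :: nat
  define e where "e n = ((\<lambda>u. (1/2) * (1 + u * u)) ^^ n) (0::real)" for n :: nat
  have y: "y 0 = 0" "y (Suc n) = (1/2) *\<^sub>R (x + y n * y n)" for n
    by (simp_all add: y_def)
  have e: "e 0 = 0" "e (Suc n) = (1/2) * (1 + e n * e n)" for n
    by (simp_all add: e_def)
  have e01: "0 \<le> e n \<and> e n \<le> 1" for n
  proof (induction n)
    case (Suc n)
    then have "e n * e n \<le> 1 * 1"
      by (intro mult_mono) auto
    then show ?case
      by (simp add: e)
  qed (simp add: e)
  have ye: "norm (y n) \<le> e n" for n
  proof (induction n)
    case (Suc n)
    have "norm (x + y n * y n) \<le> norm x + norm (y n) * norm (y n)"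
      by (meson norm_triangle_ineq norm_mult_ineq order_trans add_left_mono)
    also have "\<dots> \<le> 1 + e n * e n"
      using x Suc e01[of n] by (intro add_mono mult_mono) auto
    finally show ?case
      by (simp add: e y)
  qed (simp add: e y)
  have step: "norm (y (Suc n) - y n) \<le> e (Suc n) - e n" for n
  proof (induction n)
    case 0
    show ?case
      using x by (simp add: e y)
  next
    case (Suc n)
    let ?d = "y (Suc n) - y n"
    \<comment> \<open>A difference of squares factored without commutativity; the increments of
      \<open>e\<close> factor in the same way, so the estimates match term by term.\<close>
    have "y (Suc (Suc n)) - y (Suc n) = (1/2) *\<^sub>R (y (Suc n) * ?d + ?d * y n)"
      by (simp add: y(2)[of "Suc n"] y(2)[of n] algebra_simps)
    then have "norm (y (Suc (Suc n)) - y (Suc n)) = (1/2) * norm (y (Suc n) * ?d + ?d * y n)"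
      by simp
    also have "\<dots> \<le> (1/2) * (norm (y (Suc n)) * norm ?d + norm ?d * norm (y n))"
      by (intro mult_left_mono order_trans[OF norm_triangle_ineq] add_mono norm_mult_ineq) auto
    also have "\<dots> \<le> (1/2) * (e (Suc n) * (e (Suc n) - e n) + (e (Suc n) - e n) * e n)"
      using Suc ye[of n] ye[of "Suc n"] e01[of n] e01[of "Suc n"] order_trans[OF norm_ge_zero Suc]
      by (intro mult_left_mono add_mono mult_mono) auto
    also have "\<dots> = e (Suc (Suc n)) - e (Suc n)"
      by (simp add: e(2)[of "Suc n"] e(2)[of n] algebra_simps)
    finally show ?case .
  qed
  have "summable (\<lambda>n. e (Suc n) - e n)"
  proof -
    have "incseq e"
      using step by (intro incseq_SucI) (smt (verit) norm_ge_zero)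
    then have "convergent e"
      using e01 by (intro Bseq_monoseq_convergent BseqI'[of _ 1]) (auto simp: incseq_imp_monoseq)
    then show ?thesis
      by (auto simp: convergent_def intro: telescope_summable)
  qed
  then have "summable (\<lambda>n. y (Suc n) - y n)"
    using step by (rule summable_comparison_test'[where N=0])
  moreover have "(\<Sum>k<n. y (Suc k) - y k) = y n" for n
    by (simp only: sum_lessThan_telescope y(1)) simp
  ultimately obtain l where l: "y \<longlonglongrightarrow> l"
    by (auto simp: summable_def sums_def)
  have "(\<lambda>n. y (Suc n)) \<longlonglongrightarrow> (1/2) *\<^sub>R (x + l * l)"
    unfolding y by (intro tendsto_intros l)
  then have lfix: "l = (1/2) *\<^sub>R (x + l * l)"
    using l LIMSEQ_Suc LIMSEQ_unique by blast
  have ysa: "star (y n) = y n" for n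
    by (induction n) (simp_all add: y star_mult sa)
  have lsa: "star l = l"
    using tendsto_star[OF l] l LIMSEQ_unique by (simp add: ysa)
  have "norm l \<le> 1"
    using ye e01 by (intro LIMSEQ_le_const2[OF tendsto_norm[OF l]]) (meson order_trans)
  have comm: "z * l = l * z" if z: "z * x = x * z" for z
  proof -
    have "z * y n = y n * z" for n
      by (induction n) (simp_all add: y z algebra_simps, metis mult.assoc)
    moreover have "(\<lambda>n. z * y n) \<longlonglongrightarrow> z * l" "(\<lambda>n. y n * z) \<longlonglongrightarrow> l * z"
      by (intro tendsto_intros l)+
    ultimately show ?thesis
      using LIMSEQ_unique by simp
  qed
  have "2 *\<^sub>R l = x + l * l"
    using arg_cong[OF lfix, of "\<lambda>t. 2 *\<^sub>R t"] by simp
  then have "(1 - l) * (1 - l) = 1 - x"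
    by (simp add: algebra_simps scaleR_2)
  moreover have "z * (1 - l) = (1 - l) * z" if "z * x = x * z" for z
    using comm[OF that] by (simp add: algebra_simps)
  moreover have "star (1 - l) = 1 - l" "norm (1 - (1 - l)) \<le> 1"
    using lsa \<open>norm l \<le> 1\<close> by simp_all
  ultimately show thesis
    using that by blast
qed

text \<open>For self-adjoint \<open>h\<close> the norm bound says that the spectrum lies between
  \<open>0\<close> and \<open>2 * t\<close>. Dividing by \<open>t\<close> reduces to
  \<open>selfadjoint_sqrt_unit\<close>. The root satisfies the same kind of bound with
  \<open>sqrt t\<close>, which later makes the root positive as well.\<close>

lemma selfadjoint_sqrt:
  fixes h :: "'a::cstar_algebra_1"
  assumes sa: "star h = h" and h: "norm (t *\<^sub>R 1 - h) \<le> t"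
  obtains s where "star s = s" "norm (sqrt t *\<^sub>R 1 - s) \<le> sqrt t" "s * s = h"
    "\<And>z. z * h = h * z \<Longrightarrow> z * s = s * z"
proof (cases "t = 0")
  case True
  then show ?thesis
    using that[of 0] h by simp
next
  case False
  then have t: "t > 0"
    using h norm_ge_zero[of "t *\<^sub>R 1 - h"] by linarith
  define x where "x = 1 - (1/t) *\<^sub>R h"
  have "x = (1/t) *\<^sub>R (t *\<^sub>R 1 - h)"
    using t by (simp add: x_def algebra_simps)
  then have "norm x \<le> 1"
    using h t by simp
  moreover have "star x = x"
    by (simp add: x_def sa)
  ultimately obtain s where s: "star s = s" "norm (1 - s) \<le> 1" "s * s = 1 - x"
      "\<And>z. z * x = x * z \<Longrightarrow> z * s = s * z"
    using selfadjoint_sqrt_unit by blast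
  have "z * (sqrt t *\<^sub>R s) = (sqrt t *\<^sub>R s) * z" if "z * h = h * z" for z
    using s(4)[of z] that by (simp add: x_def algebra_simps)
  moreover have "(sqrt t *\<^sub>R s) * (sqrt t *\<^sub>R s) = h"
    using t by (simp add: s(3) x_def)
  moreover have "norm (sqrt t *\<^sub>R 1 - sqrt t *\<^sub>R s) \<le> sqrt t"
  proof -
    have "norm (sqrt t *\<^sub>R 1 - sqrt t *\<^sub>R s) = sqrt t * norm (1 - s)"
      using t by (simp flip: scaleR_diff_right)
    then show ?thesis
      using s(2) t by simp
  qed
  ultimately show ?thesis
    using that[of "sqrt t *\<^sub>R s"] s(1) by simp
qed

text \<open>Positivity is developed for squares of self-adjoint elements, which the square root
  lemmas control directly. Agreement with \<open>cstar_pos\<close> is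
  \<open>cstar_pos_iff_nonneg\<close> and rests on \<open>nonneg_star_mult\<close>.\<close>

definition nonneg :: "'a::cstar_algebra_1 \<Rightarrow> bool" where
  "nonneg a \<longleftrightarrow> (\<exists>s. star s = s \<and> a = s * s)"

lemma nonneg_selfadjoint: "nonneg a \<Longrightarrow> star a = a"
  by (auto simp: nonneg_def star_mult)

lemma nonneg_square: "star s = s \<Longrightarrow> nonneg (s * s)"
  by (auto simp: nonneg_def)

section \<open>Positivity and the norm\<close>

lemma imaginary_unit:
  fixes x :: "'a::cstar_algebra_1"
  shows "\<i> *\<^sub>C \<i> *\<^sub>C x = - x"
  using scaleC_of_real[of "-1" x] by (simp add: scaleC_scaleC)

lemma star_imaginary:
  fixes x :: "'a::cstar_algebra_1"
  shows "star (\<i> *\<^sub>C x) = - (\<i> *\<^sub>C star x)"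
proof -
  have "star (\<i> *\<^sub>C x) = (-1 * \<i>) *\<^sub>C star x"
    by (simp add: star_scaleC)
  also have "\<dots> = complex_of_real (-1) *\<^sub>C \<i> *\<^sub>C star x"
    by (simp only: scaleC_scaleC) simp
  finally show ?thesis
    by (simp only: scaleC_of_real) simp
qed

lemma scaleC_diff_right: "c *\<^sub>C (x - y) = c *\<^sub>C x - c *\<^sub>C (y::'a::cstar_algebra_1)"
  using scaleC_add_right[of c "x - y" y] by simp

text \<open>The element \<open>s + \<i> r\<close> is normal, and \<open>s\<close> is its real part.\<close>

lemma norm_le_of_commuting_squares:
  fixes s r :: "'a::cstar_algebra_1"
  assumes s: "star s = s" and r: "star r = r" and comm: "s * r = r * s"
    and sum: "s * s + r * r = \<mu> *\<^sub>R 1"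
  shows "norm (s * s) \<le> \<bar>\<mu>\<bar>"
proof -
  let ?u = "s + \<i> *\<^sub>C r"
  have su: "star ?u = s - \<i> *\<^sub>C r"
    by (simp add: s r star_imaginary)
  have "star ?u * ?u = s * s + r * r"
    unfolding su
    by (simp add: algebra_simps scaleC_mult_left scaleC_mult_right scaleC_diff_right comm imaginary_unit)
  then have u: "(norm ?u)\<^sup>2 = \<bar>\<mu>\<bar>"
    using norm_star_mult_self[of ?u] sum by simp
  have "norm (?u + star ?u) \<le> norm ?u + norm ?u"
    using norm_triangle_ineq[of ?u "star ?u"] by (simp only: norm_star)
  moreover have "?u + star ?u = 2 *\<^sub>R s"
    by (simp only: su) (simp add: scaleR_2)
  ultimately have "norm s \<le> norm ?u"
    by simp
  then have "(norm s)\<^sup>2 \<le> (norm ?u)\<^sup>2"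
    by (intro power_mono) auto
  then show ?thesis
    using u norm_mult_selfadjoint[OF s] by simp
qed

text \<open>The complement \<open>t *\<^sub>R 1 - a\<close> has a root \<open>r\<close> commuting
  with the root \<open>s\<close> of \<open>a\<close>, and their squares add up to
  \<open>t *\<^sub>R 1\<close>. With \<open>nonneg_of_norm\<close> this characterizes positivity of
  self-adjoint elements by a norm inequality.\<close>

lemma nonneg_norm_complement:
  fixes a :: "'a::cstar_algebra_1"
  assumes a: "nonneg a" and t: "norm a \<le> t"
  shows "norm (t *\<^sub>R 1 - a) \<le> t"
proof -
  obtain s where s: "star s = s" "a = s * s"
    using a by (auto simp: nonneg_def)
  have "star (t *\<^sub>R 1 - a) = t *\<^sub>R 1 - a"
    by (simp add: nonneg_selfadjoint[OF a])
  moreover have "norm (t *\<^sub>R 1 - (t *\<^sub>R 1 - a)) \<le> t"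
    using t by simp
  ultimately obtain r where r: "star r = r" "r * r = t *\<^sub>R 1 - a"
      "\<And>z. z * (t *\<^sub>R 1 - a) = (t *\<^sub>R 1 - a) * z \<Longrightarrow> z * r = r * z"
    using selfadjoint_sqrt by blast
  have "s * r = r * s"
    by (rule r(3)) (simp add: s algebra_simps)
  then show ?thesis
    using norm_le_of_commuting_squares[of r s t] r(1,2) s t order_trans[OF norm_ge_zero t] by simp
qed

lemma nonneg_of_norm: "star a = a \<Longrightarrow> norm (t *\<^sub>R 1 - a) \<le> t \<Longrightarrow> nonneg a"
  unfolding nonneg_def by (metis selfadjoint_sqrt)

text \<open>With the bound \<open>norm a + norm b\<close> the norm criterion reduces to the triangle
  inequality.\<close>

lemma nonneg_add:
  assumes "nonneg a" "nonneg b"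
  shows "nonneg (a + b)"
proof (rule nonneg_of_norm[where t="norm a + norm b"])
  have "(norm a + norm b) *\<^sub>R 1 - (a + b) = (norm a *\<^sub>R 1 - a) + (norm b *\<^sub>R 1 - b)"
    by (simp add: algebra_simps)
  then show "norm ((norm a + norm b) *\<^sub>R 1 - (a + b)) \<le> norm a + norm b"
    using norm_triangle_ineq[of "norm a *\<^sub>R 1 - a" "norm b *\<^sub>R 1 - b"]
      nonneg_norm_complement[OF assms(1) order_refl] nonneg_norm_complement[OF assms(2) order_refl]
    by (simp only:)
qed (simp add: assms nonneg_selfadjoint)

lemma nonneg_norm_bound:
  assumes "star a = a" "norm a \<le> t"
  shows "nonneg (t *\<^sub>R 1 - a)"
  by (rule nonneg_of_norm[where t=t]) (simp_all add: assms)

lemma nonneg_sqrt: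
  assumes "nonneg a"
  obtains s where "nonneg s" "s * s = a" "\<And>z. z * a = a * z \<Longrightarrow> z * s = s * z"
proof -
  obtain s where s: "star s = s" "norm (sqrt (norm a) *\<^sub>R 1 - s) \<le> sqrt (norm a)" "s * s = a"
      "\<And>z. z * a = a * z \<Longrightarrow> z * s = s * z"
    using selfadjoint_sqrt[OF nonneg_selfadjoint[OF assms] nonneg_norm_complement[OF assms order_refl]]
    by blast
  have "nonneg s"
    using s(1,2) by (rule nonneg_of_norm)
  then show ?thesis
    using that s by blast
qed

text \<open>Again two commuting roots whose squares sum to a scalar. The scalar may have any sign;
  the choice \<open>\<mu> = 0\<close> yields \<open>nonneg_antisym\<close>.\<close>

lemma norm_le_of_nonneg:
  fixes a :: "'a::cstar_algebra_1"
  assumes a: "nonneg a" and b: "nonneg (\<mu> *\<^sub>R 1 - a)"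
  shows "norm a \<le> \<bar>\<mu>\<bar>"
proof -
  obtain s where s: "star s = s" "a = s * s"
    using a by (auto simp: nonneg_def)
  obtain r where r: "star r = r" "r * r = \<mu> *\<^sub>R 1 - a"
      "\<And>z. z * (\<mu> *\<^sub>R 1 - a) = (\<mu> *\<^sub>R 1 - a) * z \<Longrightarrow> z * r = r * z"
    using nonneg_sqrt[OF b] nonneg_selfadjoint by metis
  have "s * r = r * s"
    by (rule r(3)) (simp add: s algebra_simps)
  then show ?thesis
    using norm_le_of_commuting_squares[of s r \<mu>] r(1,2) s by simp
qed

lemma nonneg_antisym: "nonneg a \<Longrightarrow> nonneg (- a) \<Longrightarrow> a = 0"
  using norm_le_of_nonneg[of a 0] by simp

lemma square_eq_zero_iff: "star s = s \<Longrightarrow> s * s = 0 \<longleftrightarrow> s = (0::'a::cstar_algebra_1)"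
  using norm_mult_selfadjoint[of s] by (metis norm_eq_zero mult_zero_left zero_eq_power2)

section \<open>Positivity of \<open>star b * b\<close>\<close>

lemma nonneg_star_mult_add:
  fixes c :: "'a::cstar_algebra_1"
  shows "nonneg (star c * c + c * star c)"
proof -
  \<comment> \<open>Up to real factors, \<open>x\<close> and \<open>y\<close> are the real and
    imaginary parts of \<open>c\<close>; in the sum of their squares \<open>c * c\<close> and
    \<open>star c * star c\<close> cancel.\<close>
  define x where "x = c + star c"
  define y where "y = \<i> *\<^sub>C (c - star c)"
  have x: "star x = x"
    by (simp add: x_def)
  have y: "star y = y"
    by (simp add: y_def star_imaginary scaleC_diff_right)
  have "y * y = - ((c - star c) * (c - star c))"
    by (simp add: y_def scaleC_mult_left scaleC_mult_right imaginary_unit)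
  then have "x * x + y * y = 2 *\<^sub>R (star c * c + c * star c)"
    by (simp add: x_def algebra_simps scaleR_2)
  moreover obtain s where s: "star s = s" "x * x + y * y = s * s"
    using nonneg_add[OF nonneg_square[OF x] nonneg_square[OF y]] by (auto simp: nonneg_def)
  ultimately have "2 *\<^sub>R (star c * c + c * star c) = s * s"
    by (simp only:)
  then have "(1/2) *\<^sub>R (s * s) = star c * c + c * star c"
    by (metis scaleR_half_double scaleR_2 scaleR_scaleR)
  then have "star c * c + c * star c = (sqrt (1/2) *\<^sub>R s) * (sqrt (1/2) *\<^sub>R s)"
    by simp
  then show ?thesis
    using nonneg_square[of "sqrt (1/2) *\<^sub>R s"] s(1) by simp
qed

text \<open>With \<open>c\<^sup>* c = - w\<^sup>2\<close> and \<open>p = c c\<^sup>*\<close>, the element \<open>d = w c\<^sup>*\<close> satisfies \<open>d\<^sup>* d = - p\<^sup>2\<close> and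
  \<open>d d\<^sup>* = - w\<^sup>4\<close>, so \<open>d\<^sup>* d + d d\<^sup>*\<close> is both positive and negative.\<close>

lemma star_mult_nonpos_imp_zero:
  fixes c :: "'a::cstar_algebra_1"
  assumes "nonneg (- (star c * c))"
  shows "c = 0"
proof -
  obtain w where w: "star w = w" "star c * c = - (w * w)"
    using assms unfolding nonneg_def by (metis minus_minus)
  define p where "p = c * star c"
  define d where "d = w * star c"
  have p: "star p = p" and ww: "star (w * w) = w * w"
    by (simp_all add: p_def star_mult w)
  have sc: "star c * (c * z) = - (w * (w * z))" for z
    using arg_cong[OF w(2), of "\<lambda>t. t * z"] by (simp add: mult.assoc)
  have "star d * d = c * (w * (w * star c))"
    by (simp add: d_def star_mult w mult.assoc)
  also have "\<dots> = - (p * p)"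
    by (simp add: p_def mult.assoc sc)
  finally have dd1: "star d * d = - (p * p)" .
  have dd2: "d * star d = - ((w * w) * (w * w))"
    by (simp add: d_def star_mult w mult.assoc sc)
  have pos: "nonneg (p * p)" "nonneg ((w * w) * (w * w))"
    using p ww by (simp_all add: nonneg_square)
  have "nonneg (- (p * p + (w * w) * (w * w)))"
    using nonneg_star_mult_add[of d] unfolding dd1 dd2 by simp
  then have "p * p + (w * w) * (w * w) = 0"
    using nonneg_antisym nonneg_add[OF pos] by blast
  then have "- ((w * w) * (w * w)) = p * p"
    by (simp add: add_eq_0_iff)
  then have "(w * w) * (w * w) = 0"
    using nonneg_antisym[OF pos(2)] pos(1) by simp
  then have "star c * c = 0"
    using square_eq_zero_iff[OF ww] w by simp
  then show ?thesis
    using norm_star_mult_self[of c] by simp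
qed

text \<open>With \<open>m\<close> the absolute value of \<open>a = b\<^sup>* b\<close> and \<open>n = m - a\<close>, the element \<open>c = b n\<close> satisfies
  \<open>c\<^sup>* c = n a n = - n m n\<close>.\<close>

theorem nonneg_star_mult:
  fixes b :: "'a::cstar_algebra_1"
  shows "nonneg (star b * b)"
proof -
  define a where "a = star b * b"
  have a: "star a = a"
    by (simp add: a_def star_mult)
  obtain m where m: "nonneg m" "m * m = a * a" "\<And>z. z * (a * a) = (a * a) * z \<Longrightarrow> z * m = m * z"
    using nonneg_sqrt[OF nonneg_square[OF a]] by metis
  \<comment> \<open>A root of \<open>m\<close> that commutes with \<open>n\<close> exhibits
    \<open>n * m * n\<close> as the square of the self-adjoint \<open>n * q\<close>.\<close>
  obtain q where q: "nonneg q" "q * q = m" "\<And>z. z * m = m * z \<Longrightarrow> z * q = q * z"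
    using nonneg_sqrt[OF m(1)] by metis
  define n where "n = m - a"
  have sa: "star m = m" "star q = q" "star n = n"
    using a m(1) q(1) by (simp_all add: n_def nonneg_selfadjoint)
  have am: "a * m = m * a"
    by (rule m(3)) (simp add: mult.assoc)
  have nq: "n * q = q * n"
    by (rule q(3)) (simp add: n_def algebra_simps am)
  have na: "n * a = - (n * m)"
    by (simp add: n_def algebra_simps am m(2))
  have "star (b * n) * (b * n) = n * a * n"
    by (simp add: star_mult sa a_def mult.assoc)
  also have "\<dots> = - ((n * q) * (q * n))"
    by (simp add: na q(2)[symmetric] mult.assoc)
  finally have bn: "star (b * n) * (b * n) = - ((n * q) * (n * q))"
    by (simp add: nq)
  have nq_sa: "star (n * q) = n * q"
    by (simp add: star_mult sa nq)
  have "b * n = 0"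
    using bn nonneg_square[OF nq_sa] by (intro star_mult_nonpos_imp_zero) simp
  then have "n * q = 0"
    using bn square_eq_zero_iff[OF nq_sa] by simp
  then have "n * m = 0"
    using q(2) by (metis mult.assoc mult_zero_left)
  then have "n * n = 0"
    using na unfolding n_def by (simp add: right_diff_distrib)
  then have "m = a"
    using square_eq_zero_iff[OF sa(3)] by (simp add: n_def)
  then show ?thesis
    using m(1) by (simp add: a_def)
qed

section \<open>The order of the algebra\<close>

lemma cstar_pos_iff_nonneg: "cstar_pos a \<longleftrightarrow> nonneg a"
  unfolding cstar_pos_def using nonneg_star_mult by (auto simp: nonneg_def) metis

lemma cstar_le_iff_nonneg: "a \<preceq> b \<longleftrightarrow> nonneg (b - a)"
  by (simp add: cstar_le_def cstar_pos_iff_nonneg)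

lemma cstar_le_trans [trans]: "a \<preceq> b \<Longrightarrow> b \<preceq> c \<Longrightarrow> a \<preceq> c"
  unfolding cstar_le_iff_nonneg using nonneg_add by fastforce

lemma cstar_le_add_mono: "a \<preceq> b \<Longrightarrow> c \<preceq> d \<Longrightarrow> a + c \<preceq> b + d"
  unfolding cstar_le_iff_nonneg using nonneg_add[of "b - a" "d - c"] by (simp add: algebra_simps)

lemma nonneg_scaleR: "nonneg a \<Longrightarrow> 0 \<le> r \<Longrightarrow> nonneg (r *\<^sub>R a)"
  using nonneg_square[of "sqrt r *\<^sub>R s" for s] by (force simp: nonneg_def[of a])

lemma cstar_le_scaleR_mono: "a \<preceq> b \<Longrightarrow> 0 \<le> r \<Longrightarrow> r *\<^sub>R a \<preceq> r *\<^sub>R b"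
  unfolding cstar_le_iff_nonneg using nonneg_scaleR by (fastforce simp flip: scaleR_diff_right)

lemma cstar_le_scaleR_left_mono: "nonneg a \<Longrightarrow> r \<le> s \<Longrightarrow> r *\<^sub>R a \<preceq> s *\<^sub>R a"
  unfolding cstar_le_iff_nonneg using nonneg_scaleR[of a "s - r"] by (simp add: algebra_simps)

lemma nonneg_conjugate:
  assumes "nonneg a"
  shows "nonneg (z * a * star z)"
proof -
  obtain s where "star s = s" "a = s * s"
    using assms by (auto simp: nonneg_def)
  then show ?thesis
    using nonneg_star_mult[of "s * star z"] by (simp add: star_mult mult.assoc)
qed

text \<open>\<open>b\<close> lies below its norm times the unit, hence so does \<open>a\<close>, and
  \<open>norm_le_of_nonneg\<close> applies.\<close>

lemma norm_mono_nonneg: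
  assumes a: "nonneg a" and ab: "a \<preceq> b"
  shows "norm a \<le> norm b"
proof -
  have "nonneg b"
    using nonneg_add[OF a, of "b - a"] ab by (simp add: cstar_le_iff_nonneg)
  then have "b \<preceq> norm b *\<^sub>R 1"
    by (simp add: cstar_le_iff_nonneg nonneg_norm_bound nonneg_selfadjoint)
  with ab have "a \<preceq> norm b *\<^sub>R 1"
    by (rule cstar_le_trans)
  then show ?thesis
    using norm_le_of_nonneg[OF a, of "norm b"] by (simp add: cstar_le_iff_nonneg)
qed

text \<open>In the norm criterion for \<open>a + \<epsilon> *\<^sub>R 1\<close> with bound
  \<open>norm a + \<epsilon>\<close> the two shifts cancel, leaving a real inequality about the
  fixed element \<open>norm a *\<^sub>R 1 - a\<close>.\<close>

lemma nonneg_epsilon: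
  assumes a: "star a = a" and pos: "\<And>\<epsilon>. 0 < \<epsilon> \<Longrightarrow> nonneg (a + \<epsilon> *\<^sub>R 1)"
  shows "nonneg a"
proof (rule nonneg_of_norm[OF a], rule field_le_epsilon)
  fix \<epsilon> :: real
  assume \<epsilon>: "0 < \<epsilon>"
  have "norm (a + \<epsilon> *\<^sub>R 1) \<le> norm a + \<epsilon>"
    using norm_triangle_ineq[of a "\<epsilon> *\<^sub>R 1"] \<epsilon> by simp
  from nonneg_norm_complement[OF pos[OF \<epsilon>] this]
  show "norm (norm a *\<^sub>R 1 - a) \<le> norm a + \<epsilon>"
    by (simp add: algebra_simps)
qed

text \<open>\<open>1 + x * u\<close> and \<open>1 + u * x\<close> are contractions in
  \<open>u\<close>; their fixed points are a right and a left inverse, which coincide by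
  associativity.\<close>

lemma one_minus_invertible:
  fixes x :: "'a::{real_normed_algebra_1, banach}"
  assumes x: "norm x < 1"
  obtains m where "(1 - x) * m = 1" "m * (1 - x) = 1"
proof -
  have "dist (1 + x * u) (1 + x * v) \<le> norm x * dist u v" for u v
    using norm_mult_ineq[of x "u - v"] by (simp add: dist_norm algebra_simps)
  then obtain u where u: "1 + x * u = u"
    using banach_fix_type[of "norm x" "\<lambda>u. 1 + x * u"] x by (auto simp: Ex1_def)
  have "dist (1 + u * x) (1 + v * x) \<le> norm x * dist u v" for u v
    using norm_mult_ineq[of "u - v" x] by (simp add: dist_norm algebra_simps)
  then obtain v where v: "1 + v * x = v"
    using banach_fix_type[of "norm x" "\<lambda>u. 1 + u * x"] x by (auto simp: Ex1_def)
  have *: "(1 - x) * u = 1" "v * (1 - x) = 1"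
    using u v by (simp_all add: algebra_simps)
  then have "v = u"
    by (metis mult.assoc mult_1_left mult_1_right)
  then show thesis
    using that * by blast
qed

lemma nonneg_add_scalar_invertible:
  fixes b :: "'a::cstar_algebra_1"
  assumes b: "nonneg b" and \<epsilon>: "0 < \<epsilon>"
  obtains m where "(b + \<epsilon> *\<^sub>R 1) * m = 1" "m * (b + \<epsilon> *\<^sub>R 1) = 1"
proof -
  define t where "t = norm b + \<epsilon>"
  have t: "0 < t"
    using \<epsilon> norm_ge_zero[of b] unfolding t_def by linarith
  \<comment> \<open>Chosen so that \<open>b + \<epsilon> *\<^sub>R 1\<close> is
    \<open>t *\<^sub>R (1 - x)\<close> with \<open>norm x < 1\<close>.\<close>
  define x where "x = (1/t) *\<^sub>R (norm b *\<^sub>R 1 - b)"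
  have "norm (norm b *\<^sub>R 1 - b) < t"
    using nonneg_norm_complement[OF b order_refl] \<epsilon> by (simp add: t_def)
  then have "norm x < 1"
    using t by (simp add: x_def)
  then obtain m where m: "(1 - x) * m = 1" "m * (1 - x) = 1"
    using one_minus_invertible by blast
  have "b + \<epsilon> *\<^sub>R 1 = t *\<^sub>R (1 - x)"
    using t by (simp add: x_def algebra_simps) (simp add: t_def algebra_simps)
  then show thesis
    using that[of "(1/t) *\<^sub>R m"] m t by simp
qed

text \<open>Conjugating with \<open>d = (b + \<epsilon>)\<^sup>-\<^sup>1\<^sup>/\<^sup>2\<close> turns \<open>b\<close> into an element of norm at most \<open>1\<close>, so \<open>d a d \<le> 1\<close>;
  conjugating back gives \<open>a \<le> b + \<epsilon>\<close>.\<close>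

lemma cstar_le_of_norm_conjugate:
  fixes a b :: "'a::cstar_algebra_1"
  assumes a: "star a = a" and b: "nonneg b"
    and le: "\<And>z. norm (z * a * star z) \<le> norm (z * b * star z)"
  shows "a \<preceq> b"
  unfolding cstar_le_iff_nonneg
proof (rule nonneg_epsilon)
  show "star (b - a) = b - a"
    by (simp add: a b nonneg_selfadjoint)
  fix \<epsilon> :: real
  assume \<epsilon>: "0 < \<epsilon>"
  define g where "g = b + \<epsilon> *\<^sub>R 1"
  obtain m where m: "g * m = 1" "m * g = 1"
    using nonneg_add_scalar_invertible[OF b \<epsilon>] unfolding g_def by blast
  have "nonneg g"
    using nonneg_add[OF b nonneg_scaleR[OF nonneg_square[of 1], of \<epsilon>]] \<epsilon> by (simp add: g_def)
  then obtain s where s: "nonneg s" "s * s = g"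
    using nonneg_sqrt by metis
  have ssa: "star s = s"
    using s(1) by (rule nonneg_selfadjoint)
  \<comment> \<open>As \<open>m\<close> inverts \<open>s * s\<close>, this is the inverse of
    \<open>s\<close>.\<close>
  define d where "d = m * s"
  have ms: "m * s = s * m"
  proof -
    have "m * s = m * (s * (g * m))"
      using m by simp
    also have "\<dots> = (m * g) * s * m"
      by (simp add: mult.assoc flip: s(2))
    finally show ?thesis
      using m by simp
  qed
  have ds: "d * s = 1" "s * d = 1"
    using m s(2) ms by (simp_all add: d_def) (metis mult.assoc)+
  have dsa: "star d = d"
  proof -
    have "star d * s = 1"
      using arg_cong[OF ds(2), of star] by (simp add: star_mult ssa)
    then show ?thesis
      using ds(2) by (metis mult.assoc mult_1_left mult_1_right)
  qed
  have "d * g * d = 1"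
    using ds by (metis s(2) mult.assoc mult_1_left)
  then have "d * b * d + \<epsilon> *\<^sub>R (d * d) = 1"
    by (simp add: g_def algebra_simps)
  then have "d * b * d \<preceq> 1 *\<^sub>R 1"
    unfolding cstar_le_iff_nonneg
    using nonneg_scaleR[OF nonneg_square[OF dsa], of \<epsilon>] \<epsilon> by (metis add_diff_cancel_left' less_imp_le scaleR_one)
  then have "norm (d * b * d) \<le> 1"
    using norm_mono_nonneg[of "d * b * d" "1 *\<^sub>R 1"] nonneg_conjugate[OF b, of d] by (simp add: dsa)
  then have "norm (d * a * d) \<le> 1"
    using le[of d] by (simp add: dsa)
  then have "nonneg (1 *\<^sub>R 1 - d * a * d)"
    by (intro nonneg_norm_bound) (simp_all add: star_mult a dsa mult.assoc)
  then have "nonneg (s * (1 - d * a * d) * s)"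
    using nonneg_conjugate[of "1 - d * a * d" s] by (simp add: ssa)
  also have "s * (1 - d * a * d) * s = s * s - (s * d) * a * (d * s)"
    by (simp add: algebra_simps)
  finally show "nonneg (b - a + \<epsilon> *\<^sub>R 1)"
    by (simp add: ds s(2)) (simp add: g_def algebra_simps)
qed

section \<open>Closed linear relations between Banach spaces\<close>

text \<open>This contains the open mapping theorem and the closed graph theorem.\<close>

lemma closed_relation_bounded_selection:
  fixes G :: "('a::banach \<times> 'b::banach) set"
  assumes G: "closed G" "subspace G" and S: "closed S" "subspace S"
    and ex: "\<And>z. z \<in> S \<Longrightarrow> \<exists>x. (z, x) \<in> G"
  obtains k where "k > 0" "\<And>z. z \<in> S \<Longrightarrow> \<exists>x. (z, x) \<in> G \<and> norm x \<le> k * norm z"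
proof -
  \<comment> \<open>Baire category: the sets \<open>A n\<close> exhaust \<open>S\<close>, so the
    closure of one of them has interior points relative to \<open>S\<close>.\<close>
  define A where "A n = {z \<in> S. \<exists>x. (z, x) \<in> G \<and> norm x \<le> real n}" for n
  have AS: "closure (A n) \<subseteq> S" for n
    using S(1) by (intro closure_minimal) (auto simp: A_def)
  have "S = (\<Union>n. closure (A n))"
  proof
    show "S \<subseteq> (\<Union>n. closure (A n))"
    proof
      fix z assume z: "z \<in> S"
      then obtain x where "(z, x) \<in> G"
        using ex by blast
      moreover obtain n where "norm x \<le> real n"
        using real_arch_simple by blast
      ultimately have "z \<in> A n"
        using z by (auto simp: A_def)
      then show "z \<in> (\<Union>n. closure (A n))"
        using closure_subset by blast
    qed
  qed (use AS in blast)
  then have "top_of_set S interior_of \<Union> (range (\<lambda>n. closure (A n))) \<noteq> {}"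
    using subspace_0[OF S(2)] interior_of_topspace[of "top_of_set S"] by force
  moreover have "completely_metrizable_space (top_of_set S)"
    using completely_metrizable_space_closedin[OF completely_metrizable_space_euclidean, of S] S(1) by simp
  moreover have "closedin (top_of_set S) (closure (A n))" for n
    using AS by (simp add: closed_subset)
  ultimately obtain n where "top_of_set S interior_of closure (A n) \<noteq> {}"
    using Baire_category_alt[of "top_of_set S" "range (\<lambda>n. closure (A n))"] by auto
  then obtain z0 U where U: "openin (top_of_set S) U" "U \<subseteq> closure (A n)" "z0 \<in> U"
    by (auto simp: interior_of_def)
  then obtain e where e: "e > 0" "ball z0 e \<inter> S \<subseteq> U" and z0: "z0 \<in> S"
    by (metis openin_contains_ball openin_imp_subset subsetD)
  \<comment> \<open>Subtracting approximations of \<open>z0\<close> from those of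
    \<open>z0 + z\<close> moves the interior point to the origin and doubles the bound
    \<open>n\<close>.\<close>
  have near: "\<exists>z' x. z' \<in> S \<and> (z', x) \<in> G \<and> norm x \<le> 2 * n \<and> norm (z - z') < \<delta>"
    if z: "z \<in> S" "norm z < e" and \<delta>: "\<delta> > 0" for z \<delta>
  proof -
    have "z0 + z \<in> closure (A n)" "z0 \<in> closure (A n)"
      using e U z z0 subspace_add[OF S(2) z0 z(1)] by (auto simp: dist_norm subset_iff)
    then obtain p q where pq: "p \<in> A n" "dist p (z0 + z) < \<delta>/2" "q \<in> A n" "dist q z0 < \<delta>/2"
      using \<delta> unfolding closure_approachable by (metis half_gt_zero)
    then obtain x y where xy: "(p, x) \<in> G" "norm x \<le> n" "(q, y) \<in> G" "norm y \<le> n" "p \<in> S" "q \<in> S"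
      by (auto simp: A_def)
    have "(p - q, x - y) \<in> G"
      using subspace_diff[OF G(2) xy(1,3)] by simp
    moreover have "norm (x - y) \<le> 2 * n"
      using norm_triangle_ineq4[of x y] xy by linarith
    moreover have "norm (z - (p - q)) < \<delta>"
      using norm_triangle_ineq4[of "q - z0" "p - (z0 + z)"] pq by (simp add: dist_norm algebra_simps)
    ultimately show ?thesis
      using subspace_diff[OF S(2) xy(5,6)] by blast
  qed
  define c where "c = 4 * n / e"
  have c: "c \<ge> 0"
    using e by (simp add: c_def)
  have "\<exists>z' x. z' \<in> S \<and> (z', x) \<in> G \<and> norm x \<le> c * norm z \<and> norm (z - z') \<le> norm z / 2"
    if z: "z \<in> S" for z
  proof (cases "z = 0")
    case True
    then show ?thesis
      using subspace_0[OF G(2)] subspace_0[OF S(2)] by (auto simp: zero_prod_def)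
  next
    case False
    \<comment> \<open>Scaling to norm \<open>e / 2\<close> allows an approximation within
      \<open>e / 4\<close>; scaling back, the error is half of \<open>norm z\<close>, and the bound
      \<open>2 * n\<close> becomes \<open>c * norm z\<close>.\<close>
    define r where "r = e / (2 * norm z)"
    have r: "r > 0"
      using False e by (simp add: r_def)
    have "r *\<^sub>R z \<in> S" "norm (r *\<^sub>R z) < e" "e / 4 > 0"
      using False e subspace_mul[OF S(2) z] by (simp_all add: r_def)
    then obtain p x where px: "p \<in> S" "(p, x) \<in> G" "norm x \<le> 2 * n" "norm (r *\<^sub>R z - p) < e/4"
      using near by blast
    have "(1/r) *\<^sub>R p \<in> S" "((1/r) *\<^sub>R p, (1/r) *\<^sub>R x) \<in> G"
      using subspace_mul[OF S(2) px(1)] subspace_mul[OF G(2) px(2), of "1/r"] by simp_all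
    moreover have "norm ((1/r) *\<^sub>R x) \<le> c * norm z"
      using r px(3) e False by (simp add: r_def c_def field_simps)
    moreover have "norm (z - (1/r) *\<^sub>R p) \<le> norm z / 2"
    proof -
      have "z - (1/r) *\<^sub>R p = (1/r) *\<^sub>R (r *\<^sub>R z - p)"
        using r by (simp add: algebra_simps)
      then have "norm (z - (1/r) *\<^sub>R p) = (1/r) * norm (r *\<^sub>R z - p)"
        using r by simp
      also have "\<dots> \<le> (1/r) * (e/4)"
        using r px by (intro mult_left_mono) auto
      finally show ?thesis
        using e False by (simp add: r_def)
    qed
    ultimately show ?thesis
      by blast
  qed
  then obtain f g where fg: "\<And>z. z \<in> S \<Longrightarrow> f z \<in> S \<and> (f z, g z) \<in> G \<and>
      norm (g z) \<le> c * norm z \<and> norm (z - f z) \<le> norm z / 2"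
    by metis
  have "\<exists>x. (z, x) \<in> G \<and> norm x \<le> (2 * c + 1) * norm z" if z: "z \<in> S" for z
  proof -
    \<comment> \<open>The residuals of successive approximation. The corrections
      \<open>f (w i)\<close> telescope to \<open>z\<close>, while the norms of the
      \<open>g (w i)\<close> are dominated by a geometric series of sum
      \<open>2 * c * norm z\<close>.\<close>
    define w where "w i = ((\<lambda>z. z - f z) ^^ i) z" for i :: nat
    have w: "w 0 = z" "w (Suc i) = w i - f (w i)" for i
      by (simp_all add: w_def)
    have wS: "w i \<in> S" for i
      by (induction i) (use fg z S(2) in \<open>auto simp: w intro: subspace_diff\<close>)
    have wn: "norm (w i) \<le> norm z * (1/2) ^ i" for i
    proof (induction i)
      case (Suc i)
      have "norm (w (Suc i)) \<le> norm (w i) / 2"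
        using fg[OF wS[of i]] by (simp add: w)
      then show ?case
        using Suc by simp
    qed (simp add: w)
    have "w \<longlonglongrightarrow> 0"
    proof (rule Lim_null_comparison)
      show "\<forall>\<^sub>F i in sequentially. norm (w i) \<le> norm z * (1/2) ^ i"
        using wn by simp
      show "(\<lambda>i. norm z * (1/2) ^ i) \<longlonglongrightarrow> 0"
        by (intro tendsto_mult_right_zero LIMSEQ_power_zero) simp
    qed
    have sf: "(\<Sum>i<n. f (w i)) = z - w n" for n
      by (induction n) (simp_all add: w)
    have gn: "norm (g (w i)) \<le> (c * norm z) * (1/2) ^ i" for i
      using fg[OF wS[of i]] mult_left_mono[OF wn[of i] c] by (simp add: mult.assoc)
    have geo: "(\<lambda>i. (c * norm z) * (1/2) ^ i) sums ((c * norm z) * 2)"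
      using geometric_sums[of "1/2::real"] by (intro sums_mult) simp
    have sg: "summable (\<lambda>i. norm (g (w i)))"
      by (rule summable_comparison_test'[OF sums_summable[OF geo], where N=0]) (use gn in auto)
    define x where "x = (\<Sum>i. g (w i))"
    have x: "(\<lambda>n. \<Sum>i<n. g (w i)) \<longlonglongrightarrow> x"
      unfolding x_def using summable_LIMSEQ[OF summable_norm_cancel[OF sg]] .
    \<comment> \<open>Partial sums lie in \<open>G\<close> by linearity, and closedness of
      \<open>G\<close> passes this to the limit.\<close>
    have "(\<lambda>n. (z - w n, \<Sum>i<n. g (w i))) \<longlonglongrightarrow> (z - 0, x)"
      by (intro tendsto_intros x \<open>w \<longlonglongrightarrow> 0\<close>)
    moreover have "(z - w n, \<Sum>i<n. g (w i)) \<in> G" for n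
    proof -
      have "(\<Sum>i<n. (f (w i), g (w i))) \<in> G"
        using fg wS G(2) by (intro subspace_sum) auto
      then show ?thesis
        by (simp add: sum_prod sf)
    qed
    ultimately have "(z, x) \<in> G"
      using closed_sequentially[OF G(1)] by fastforce
    moreover have "norm x \<le> (2 * c + 1) * norm z"
    proof -
      have "norm x \<le> (\<Sum>i. norm (g (w i)))"
        unfolding x_def by (rule summable_norm[OF sg])
      also have "\<dots> \<le> c * norm z * 2"
        using suminf_le[OF gn sg sums_summable[OF geo]] sums_unique[OF geo] by simp
      finally show ?thesis
        by (simp add: algebra_simps add_increasing)
    qed
    ultimately show ?thesis
      by blast
  qed
  \<comment> \<open>The added \<open>1\<close> keeps the constant positive even if
    \<open>c = 0\<close>.\<close>
  then show thesis
    using that[of "2 * c + 1"] c by simp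
qed

section \<open>Linearity of the strong integral\<close>

lemma strongly_measurable_add:
  assumes "strongly_measurable M f" "strongly_measurable M g"
  shows "strongly_measurable M (\<lambda>x. f x + g x)"
proof -
  obtain s where "\<And>i. simple_function M (s i)" "\<And>x. x \<in> space M \<Longrightarrow> (\<lambda>i::nat. s i x) \<longlonglongrightarrow> f x"
    using assms(1) by (auto simp: strongly_measurable_def)
  moreover obtain t where "\<And>i. simple_function M (t i)" "\<And>x. x \<in> space M \<Longrightarrow> (\<lambda>i::nat. t i x) \<longlonglongrightarrow> g x"
    using assms(2) by (auto simp: strongly_measurable_def)
  ultimately show ?thesis
    unfolding strongly_measurable_def
    by (intro exI[of _ "\<lambda>i x. s i x + t i x"]) (auto intro: simple_function_compose2 tendsto_add)
qed

lemma strongly_measurable_scaleR: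
  assumes "strongly_measurable M f"
  shows "strongly_measurable M (\<lambda>x. r *\<^sub>R f x)"
proof -
  obtain s where "\<And>i. simple_function M (s i)" "\<And>x. x \<in> space M \<Longrightarrow> (\<lambda>i::nat. s i x) \<longlonglongrightarrow> f x"
    using assms by (auto simp: strongly_measurable_def)
  then show ?thesis
    unfolding strongly_measurable_def
    by (intro exI[of _ "\<lambda>i x. r *\<^sub>R s i x"]) (auto intro: simple_function_compose1 tendsto_scaleR)
qed

lemma simple_bochner_integrable_imp_simple_function:
  "Bochner_Integration.simple_bochner_integrable M f \<Longrightarrow> simple_function M f"
  by (auto elim: simple_bochner_integrable.cases)

lemma has_strong_integral_add:
  assumes "has_strong_integral M f I" "has_strong_integral M g J"
  shows "has_strong_integral M (\<lambda>x. f x + g x) (I + J)"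
proof -
  obtain s where s: "\<And>i. Bochner_Integration.simple_bochner_integrable M (s i)"
      "(\<lambda>i::nat. \<integral>\<^sup>+x. ennreal (norm (f x - s i x)) \<partial>M) \<longlonglongrightarrow> 0"
      "(\<lambda>i. Bochner_Integration.simple_bochner_integral M (s i)) \<longlonglongrightarrow> I"
    and f: "strongly_measurable M f"
    using assms(1) by (auto simp: has_strong_integral_def)
  obtain t where t: "\<And>i. Bochner_Integration.simple_bochner_integrable M (t i)"
      "(\<lambda>i::nat. \<integral>\<^sup>+x. ennreal (norm (g x - t i x)) \<partial>M) \<longlonglongrightarrow> 0"
      "(\<lambda>i. Bochner_Integration.simple_bochner_integral M (t i)) \<longlonglongrightarrow> J"
    and g: "strongly_measurable M g"
    using assms(2) by (auto simp: has_strong_integral_def)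
  note meas = strong_measurable_diff_norm[OF f simple_bochner_integrable_imp_simple_function[OF s(1)]]
    strong_measurable_diff_norm[OF g simple_bochner_integrable_imp_simple_function[OF t(1)]]
  have "(\<lambda>i. \<integral>\<^sup>+x. ennreal (norm (f x + g x - (s i x + t i x))) \<partial>M) \<longlonglongrightarrow> 0"
  proof (rule tendsto_sandwich[OF _ _ tendsto_const])
    show "(\<lambda>i. (\<integral>\<^sup>+x. ennreal (norm (f x - s i x)) \<partial>M) + (\<integral>\<^sup>+x. ennreal (norm (g x - t i x)) \<partial>M)) \<longlonglongrightarrow> 0"
      using tendsto_add[OF s(2) t(2)] by simp
    have "(\<integral>\<^sup>+x. ennreal (norm (f x + g x - (s i x + t i x))) \<partial>M)
        \<le> (\<integral>\<^sup>+x. ennreal (norm (f x - s i x)) + ennreal (norm (g x - t i x)) \<partial>M)" for i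
      by (intro nn_integral_mono)
        (simp add: norm_diff_triangle_ineq flip: ennreal_plus)
    then show "\<forall>\<^sub>F i in sequentially. (\<integral>\<^sup>+x. ennreal (norm (f x + g x - (s i x + t i x))) \<partial>M)
        \<le> (\<integral>\<^sup>+x. ennreal (norm (f x - s i x)) \<partial>M) + (\<integral>\<^sup>+x. ennreal (norm (g x - t i x)) \<partial>M)"
      using meas by (simp add: nn_integral_add)
  qed simp
  moreover have "Bochner_Integration.simple_bochner_integrable M (\<lambda>x. s i x + t i x)" for i
    by (rule simple_bochner_integrable_compose2[OF _ s(1) t(1)]) simp
  moreover have "(\<lambda>i. Bochner_Integration.simple_bochner_integral M (\<lambda>x. s i x + t i x)) \<longlonglongrightarrow> I + J"
    unfolding simple_bochner_integral_add[OF s(1) t(1)] by (intro tendsto_add s t)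
  ultimately show ?thesis
    unfolding has_strong_integral_def
    by (intro conjI strongly_measurable_add f g exI[of _ "\<lambda>i x. s i x + t i x"]) auto
qed

lemma has_strong_integral_scaleR:
  assumes "has_strong_integral M f I"
  shows "has_strong_integral M (\<lambda>x. r *\<^sub>R f x) (r *\<^sub>R I)"
proof -
  obtain s where s: "\<And>i. Bochner_Integration.simple_bochner_integrable M (s i)"
      "(\<lambda>i::nat. \<integral>\<^sup>+x. ennreal (norm (f x - s i x)) \<partial>M) \<longlonglongrightarrow> 0"
      "(\<lambda>i. Bochner_Integration.simple_bochner_integral M (s i)) \<longlonglongrightarrow> I"
    and f: "strongly_measurable M f"
    using assms by (auto simp: has_strong_integral_def)
  note meas = strong_measurable_diff_norm[OF f simple_bochner_integrable_imp_simple_function[OF s(1)]]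
  have "(\<integral>\<^sup>+x. ennreal (norm (r *\<^sub>R f x - r *\<^sub>R s i x)) \<partial>M)
      = ennreal \<bar>r\<bar> * (\<integral>\<^sup>+x. ennreal (norm (f x - s i x)) \<partial>M)" for i
    using meas[of i] by (simp add: ennreal_mult nn_integral_cmult flip: scaleR_diff_right)
  moreover have "(\<lambda>i. ennreal \<bar>r\<bar> * (\<integral>\<^sup>+x. ennreal (norm (f x - s i x)) \<partial>M)) \<longlonglongrightarrow> ennreal \<bar>r\<bar> * 0"
    by (intro ennreal_tendsto_cmult s) simp
  ultimately have "(\<lambda>i. \<integral>\<^sup>+x. ennreal (norm (r *\<^sub>R f x - r *\<^sub>R s i x)) \<partial>M) \<longlonglongrightarrow> 0"
    by simp
  moreover have "Bochner_Integration.simple_bochner_integrable M (\<lambda>x. r *\<^sub>R s i x)" for i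
    by (rule simple_bochner_integrable_compose2[where p="\<lambda>x y. r *\<^sub>R x", OF _ s(1) s(1)]) simp
  moreover have "(\<lambda>i. Bochner_Integration.simple_bochner_integral M (\<lambda>x. r *\<^sub>R s i x)) \<longlonglongrightarrow> r *\<^sub>R I"
    unfolding simple_bochner_integral_linear[OF linear_scaleR s(1)] by (intro tendsto_intros s)
  ultimately show ?thesis
    unfolding has_strong_integral_def
    by (intro conjI strongly_measurable_scaleR f exI[of _ "\<lambda>i x. r *\<^sub>R s i x"]) auto
qed

section \<open>Hilbert modules and adjointable maps\<close>

context hilbert_module
begin

lemma ip_act_right: "ip x (act a y) = ip x y * star a"
  using ip_star[of x "act a y"] ip_star[of x y] by (simp only: ip_act_left star_mult)

lemma ip_scaleR_left: "ip (r *\<^sub>R x) y = r *\<^sub>R ip x y"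
  using ip_act_left[of "r *\<^sub>R 1" x y] by (simp add: act_scaleR)

lemma ip_scaleR_right: "ip x (r *\<^sub>R y) = r *\<^sub>R ip x y"
  using ip_act_right[of x "r *\<^sub>R 1" y] by (simp add: act_scaleR)

lemma nonneg_ip: "nonneg (ip x x)"
  using ip_pos by (simp add: cstar_pos_iff_nonneg)

lemma norm_ip_self: "norm (ip x x) = (norm x)\<^sup>2"
  by (simp add: norm_eq_ip)

lemma ip_eqI_left: "(\<And>z. ip x z = ip y z) \<Longrightarrow> x = y"
  by (metis ip_eqI ip_star)

theorem Cauchy_Schwarz: "norm (ip x y) \<le> norm x * norm y"
proof (cases "y = 0")
  case True
  then show ?thesis
    using ip_diff_right[of x y y] by simp
next
  case False
  define N where "N = (norm y)\<^sup>2"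
  have N: "N > 0"
    using False by (simp add: N_def)
  define e where "e = ip x y"
  have yx: "ip y x = star e"
    using ip_star[of y x] by (simp add: e_def)
  \<comment> \<open>The scalar \<open>N\<close> replaces \<open>ip y y\<close>, which need not be
    invertible. Since \<open>ip y y\<close> is at most \<open>N *\<^sub>R 1\<close>, a positive term
    can be added below that turns the quadratic term into a multiple of
    \<open>e * star e\<close>.\<close>
  define v where "v = x - act ((1/N) *\<^sub>R e) y"
  have ipv: "ip v v = ip x x - (2/N) *\<^sub>R (e * star e) + (1/N\<^sup>2) *\<^sub>R (e * ip y y * star e)"
  proof -
    have "(2/N) *\<^sub>R (e * star e) = (1/N) *\<^sub>R (e * star e) + (1/N) *\<^sub>R (e * star e)"
      by (simp flip: scaleR_add_left)
    then show ?thesis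
      by (simp add: v_def ip_diff_left ip_diff_right ip_act_left ip_act_right yx
          algebra_simps power2_eq_square flip: e_def)
  qed
  have "nonneg (N *\<^sub>R 1 - ip y y)"
    by (intro nonneg_norm_bound) (simp_all add: nonneg_selfadjoint nonneg_ip norm_ip_self N_def)
  then have "nonneg ((1/N\<^sup>2) *\<^sub>R (e * (N *\<^sub>R 1 - ip y y) * star e))"
    by (intro nonneg_scaleR nonneg_conjugate) simp_all
  then have "nonneg (ip v v + (1/N\<^sup>2) *\<^sub>R (e * (N *\<^sub>R 1 - ip y y) * star e))"
    by (rule nonneg_add[OF nonneg_ip])
  also have "(1/N\<^sup>2) *\<^sub>R (e * (N *\<^sub>R 1 - ip y y) * star e) =
      (1/N) *\<^sub>R (e * star e) - (1/N\<^sup>2) *\<^sub>R (e * ip y y * star e)"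
    using N by (simp add: algebra_simps power2_eq_square)
  also have "ip v v + \<dots> = ip x x - (1/N) *\<^sub>R (e * star e)"
  proof -
    have "(2/N) *\<^sub>R (e * star e) = (1/N) *\<^sub>R (e * star e) + (1/N) *\<^sub>R (e * star e)"
      by (simp flip: scaleR_add_left)
    then show ?thesis
      by (simp add: ipv)
  qed
  finally have "(1/N) *\<^sub>R (e * star e) \<preceq> ip x x"
    by (simp add: cstar_le_iff_nonneg)
  moreover have "nonneg ((1/N) *\<^sub>R (e * star e))"
    using nonneg_star_mult[of "star e"] N by (intro nonneg_scaleR) simp_all
  ultimately have "norm ((1/N) *\<^sub>R (e * star e)) \<le> (norm x)\<^sup>2"
    using norm_mono_nonneg norm_ip_self by metis
  then have "(norm e)\<^sup>2 \<le> (norm x)\<^sup>2 * N"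
    using norm_star_mult_self[of "star e"] N by (simp add: field_simps)
  then have "(norm e)\<^sup>2 \<le> (norm x * norm y)\<^sup>2"
    by (simp add: N_def power_mult_distrib)
  then show ?thesis
    unfolding e_def by (rule power2_le_imp_le) simp
qed

lemma bounded_linear_ip_left: "bounded_linear (\<lambda>x. ip x y)"
  by (rule bounded_linear_intro[where K="norm y"])
    (simp_all add: ip_add_left ip_scaleR_left Cauchy_Schwarz)

lemma closed_submodule_UNIV: "closed_submodule act UNIV"
  by (simp add: closed_submodule_def)

end

lemma hilbert_module_linearI:
  assumes "hilbert_module actE ipE" "hilbert_module actF ipF"
    and T: "\<And>a x y. T (actE a x + y) = actF a (T x) + T y"
  shows "linear T"
proof -
  interpret E: hilbert_module actE ipE by fact
  interpret F: hilbert_module actF ipF by fact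
  have add: "T (x + y) = T x + T y" for x y
    using T[of 1 x y] by (simp add: E.act_one F.act_one)
  have "T 0 = 0"
    using add[of 0 0] by simp
  then have "T (r *\<^sub>R x) = r *\<^sub>R T x" for r x
    using T[of "r *\<^sub>R 1" x 0] by (simp add: E.act_scaleR F.act_scaleR)
  then show ?thesis
    using add by (intro linearI)
qed

text \<open>The adjoint is carried as an explicit map \<open>S\<close>;
  \<open>adj_eq_adjoint\<close> links it to the description by \<open>adj\<close>. Linearity and
  boundedness of \<open>T\<close> follow from the single identity.\<close>

locale adjointable =
  E: hilbert_module actE ipE + F: hilbert_module actF ipF
  for actE :: "'a::cstar_algebra_1 \<Rightarrow> 'e::banach \<Rightarrow> 'e" and ipE
    and actF :: "'a \<Rightarrow> 'f::banach \<Rightarrow> 'f" and ipF +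
  fixes T :: "'e \<Rightarrow> 'f" and S :: "'f \<Rightarrow> 'e"
  assumes ip_adjoint: "ipF (T x) y = ipE x (S y)"
begin

lemma adjoint_pair: "adjoint_pair UNIV ipE UNIV ipF T S"
  by (simp add: adjoint_pair_def ip_adjoint)

lemma adj_eq_adjoint: "adj ipE ipF T = S"
  by (rule ext) (rule adj_eq[OF E.hilbert_module_axioms adjoint_pair UNIV_I])

lemma module_linear: "T (actE a x + y) = actF a (T x) + T y"
proof (rule End_adj_linear)
  show "T \<in> End_adj UNIV ipE UNIV ipF"
    using adjoint_pair by (auto simp: End_adj_def)
qed (auto simp: E.hilbert_module_axioms F.hilbert_module_axioms E.closed_submodule_UNIV
    F.closed_submodule_UNIV)

lemma linear: "linear T"
  using E.hilbert_module_axioms F.hilbert_module_axioms module_linear by (rule hilbert_module_linearI)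

lemma act: "T (actE a x) = actF a (T x)"
  using module_linear[of a x 0] linear_0[OF linear] by simp

lemma closed_graph: "closed {(x, T x) |x. True}"
  unfolding closed_sequential_limits
proof (intro allI impI, elim conjE)
  fix s :: "nat \<Rightarrow> 'e \<times> 'f" and l
  assume s: "\<forall>n. s n \<in> {(x, T x) |x. True}" and l: "s \<longlonglongrightarrow> l"
  have Ts: "snd (s n) = T (fst (s n))" for n
    using s by (smt (verit) fst_conv mem_Collect_eq snd_conv)
  \<comment> \<open>Pairing with \<open>z\<close> moves \<open>T\<close> to the other side, where
    only continuity of the inner product is used.\<close>
  have "ipF (snd l) z = ipF (T (fst l)) z" for z
  proof (rule LIMSEQ_unique)
    show "(\<lambda>n. ipF (snd (s n)) z) \<longlonglongrightarrow> ipF (snd l) z"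
      by (rule bounded_linear.tendsto[OF F.bounded_linear_ip_left tendsto_snd[OF l]])
    show "(\<lambda>n. ipF (snd (s n)) z) \<longlonglongrightarrow> ipF (T (fst l)) z"
      unfolding Ts ip_adjoint
      by (rule bounded_linear.tendsto[OF E.bounded_linear_ip_left tendsto_fst[OF l]])
  qed
  then have "snd l = T (fst l)"
    by (rule F.ip_eqI_left)
  then show "l \<in> {(x, T x) |x. True}"
    by (cases l) simp
qed

text \<open>A closed graph theorem: in the graph, the only element related to \<open>z\<close> is
  \<open>T z\<close>, so the bounded selection is \<open>T\<close> itself.\<close>

lemma bounded_linear: "bounded_linear T"
proof -
  have "subspace {(x, T x) |x. True}"
    using linear by (auto simp: subspace_def linear_add linear_scale zero_prod_def linear_0)
  then obtain k where "k > 0" "\<And>z. \<exists>x. (z, x) \<in> {(x, T x) |x. True} \<and> norm x \<le> k * norm z"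
    using closed_relation_bounded_selection[of "{(x, T x) |x. True}" UNIV] closed_graph by auto
  then have "norm (T z) \<le> norm z * k" for z
    by (fastforce simp: mult.commute)
  then show ?thesis
    using linear by (intro bounded_linear_intro[where K=k]) (auto simp: linear_add linear_scale)
qed

lemma bounded: obtains k where "k > 0" "\<And>x. norm (T x) \<le> k * norm x"
  using bounded_linear.pos_bounded[OF bounded_linear] by (metis mult.commute)

lemma adjointable_adjoint: "adjointable actF ipF actE ipE S T"
proof unfold_locales
  show "ipE (S x) y = ipF x (T y)" for x y
    using F.ip_star[of x "T y"] E.ip_star[of "S x" y] by (simp only: ip_adjoint)
qed

end

lemma adjointable_if_adjoint_pair:
  assumes "hilbert_module actE ipE" "hilbert_module actF ipF" "adjoint_pair UNIV ipE UNIV ipF T S"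
  shows "adjointable actE ipE actF ipF T S"
  using assms by (simp add: adjointable_def adjointable_axioms_def adjoint_pair_def)

lemma adjointable_if_End_adj:
  assumes "hilbert_module actE ipE" "hilbert_module actF ipF" "T \<in> End_adj UNIV ipE UNIV ipF"
  shows "adjointable actE ipE actF ipF T (adj ipE ipF T)"
proof -
  obtain S where "adjoint_pair UNIV ipE UNIV ipF T S"
    using assms(3) by (auto simp: End_adj_def)
  then have S: "adjointable actE ipE actF ipF T S"
    using assms(1,2) by (intro adjointable_if_adjoint_pair)
  then show ?thesis
    using adjointable.adj_eq_adjoint[OF S] by simp
qed

lemma adjointable_combination:
  assumes "adjointable actE ipE actF ipF T S" "adjointable actE ipE actF ipF T' S'"
  shows "adjointable actE ipE actF ipF (\<lambda>x. r *\<^sub>R T x + r' *\<^sub>R T' x) (\<lambda>y. r *\<^sub>R S y + r' *\<^sub>R S' y)"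
proof -
  interpret T: adjointable actE ipE actF ipF T S by fact
  interpret T': adjointable actE ipE actF ipF T' S' by fact
  show ?thesis
    by unfold_locales (simp add: T.F.ip_add_left T.F.ip_scaleR_left T.E.ip_add_right
        T.E.ip_scaleR_right T.ip_adjoint T'.ip_adjoint)
qed

lemma adjointable_comp:
  assumes "adjointable actE ipE actF ipF T S" "adjointable actF ipF actG ipG T' S'"
  shows "adjointable actE ipE actG ipG (\<lambda>x. T' (T x)) (\<lambda>y. S (S' y))"
proof -
  interpret T: adjointable actE ipE actF ipF T S by fact
  interpret T': adjointable actF ipF actG ipG T' S' by fact
  show ?thesis
    by unfold_locales (simp add: T.ip_adjoint T'.ip_adjoint)
qed

text \<open>If \<open>A x = C z\<close> with \<open>\<parallel>x\<parallel> \<le> k \<parallel>z\<parallel>\<close> and \<open>z = C\<^sup>* y\<close>, then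
  \<open>\<parallel>z\<parallel>\<^sup>2 = \<parallel>\<langle>C z, y\<rangle>\<parallel> = \<parallel>\<langle>x, A\<^sup>* y\<rangle>\<parallel> \<le> k \<parallel>z\<parallel> \<parallel>A\<^sup>* y\<parallel>\<close>.\<close>

lemma norm_adjoint_le_if_range:
  assumes "adjointable actZ ipZ actF ipF C C'" "adjointable actE ipE actF ipF A A'"
    and S: "closed S" "subspace S" and range: "C ` S \<subseteq> range A"
  obtains k where "k > 0" "\<And>y. C' y \<in> S \<Longrightarrow> norm (C' y) \<le> k * norm (A' y)"
proof -
  interpret C: adjointable actZ ipZ actF ipF C C' by fact
  interpret A: adjointable actE ipE actF ipF A A' by fact
  \<comment> \<open>A relation instead of a map, since \<open>A\<close> need not be injective; the
    selection picks solutions of controlled norm.\<close>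
  let ?G = "{p. C (fst p) = A (snd p)}"
  have "closed ?G"
    by (intro closed_Collect_eq bounded_linear.continuous_on[OF C.bounded_linear]
        bounded_linear.continuous_on[OF A.bounded_linear] continuous_intros)
  moreover have "subspace ?G"
    using C.linear A.linear by (auto simp: subspace_def linear_add linear_scale linear_0)
  moreover have ex: "\<exists>x. (z, x) \<in> ?G" if "z \<in> S" for z
    using range that by auto
  ultimately obtain k where k: "k > 0"
      "\<And>z. z \<in> S \<Longrightarrow> \<exists>x. (z, x) \<in> ?G \<and> norm x \<le> k * norm z"
    using closed_relation_bounded_selection[of ?G S] S ex by auto
  have "norm (C' y) \<le> k * norm (A' y)" if y: "C' y \<in> S" for y
  proof (cases "C' y = 0")
    case False
    obtain x where x: "C (C' y) = A x" "norm x \<le> k * norm (C' y)"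
      using k(2)[OF y] by auto
    have "(norm (C' y))\<^sup>2 = norm (ipE x (A' y))"
      using C.ip_adjoint[of "C' y" y] x(1) A.ip_adjoint by (simp flip: C.E.norm_ip_self)
    also have "\<dots> \<le> norm x * norm (A' y)"
      by (rule A.E.Cauchy_Schwarz)
    also have "\<dots> \<le> k * norm (C' y) * norm (A' y)"
      by (rule mult_right_mono[OF x(2)]) simp
    finally show ?thesis
      using False by (simp add: power2_eq_square)
  qed (use k in simp)
  then show thesis
    using that k(1) by blast
qed

text \<open>Conjugating \<open>ipF (C x) (C x)\<close> by \<open>z\<close> amounts to replacing
  \<open>x\<close> by \<open>actE z x\<close>, so the norm inequality at all vectors is what
  \<open>cstar_le_of_norm_conjugate\<close> asks for.\<close>

lemma ip_le_of_norm_le: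
  assumes "adjointable actE ipE actF ipF C C'" "adjointable actE ipE actG ipG D D'"
    and le: "\<And>x. norm (C x) \<le> k * norm (D x)"
  shows "ipF (C x) (C x) \<preceq> k\<^sup>2 *\<^sub>R ipG (D x) (D x)"
proof -
  interpret C: adjointable actE ipE actF ipF C C' by fact
  interpret D: adjointable actE ipE actG ipG D D' by fact
  show ?thesis
  proof (rule cstar_le_of_norm_conjugate)
    show "star (ipF (C x) (C x)) = ipF (C x) (C x)"
      by (intro nonneg_selfadjoint C.F.nonneg_ip)
    show "nonneg (k\<^sup>2 *\<^sub>R ipG (D x) (D x))"
      by (intro nonneg_scaleR D.F.nonneg_ip) simp
    fix z
    have "z * ipF (C x) (C x) * star z = ipF (C (actE z x)) (C (actE z x))"
      by (simp add: C.act C.F.ip_act_left C.F.ip_act_right mult.assoc)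
    moreover have "z * ipG (D x) (D x) * star z = ipG (D (actE z x)) (D (actE z x))"
      by (simp add: D.act D.F.ip_act_left D.F.ip_act_right mult.assoc)
    moreover have "(norm (C (actE z x)))\<^sup>2 \<le> (k * norm (D (actE z x)))\<^sup>2"
      by (intro power_mono le) simp
    ultimately show "norm (z * ipF (C x) (C x) * star z) \<le> norm (z * (k\<^sup>2 *\<^sub>R ipG (D x) (D x)) * star z)"
      by (simp add: C.F.norm_ip_self D.F.norm_ip_self power_mult_distrib)
  qed
qed

text \<open>The same conjugation argument for a quadratic form, with the norm estimate from
  Cauchy-Schwarz. It will bound the cross terms from above.\<close>

lemma ip_form_bounded:
  assumes "adjointable actE ipE actE ipE R R'" and pos: "\<And>x. nonneg (ipE (R x) x)"
  obtains k where "k > 0" "\<And>x. ipE (R x) x \<preceq> k *\<^sub>R ipE x x"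
proof -
  interpret R: adjointable actE ipE actE ipE R R' by fact
  obtain k where k: "k > 0" "\<And>x. norm (R x) \<le> k * norm x"
    using R.bounded by blast
  have "ipE (R x) x \<preceq> k *\<^sub>R ipE x x" for x
  proof (rule cstar_le_of_norm_conjugate)
    show "star (ipE (R x) x) = ipE (R x) x"
      using pos by (rule nonneg_selfadjoint)
    show "nonneg (k *\<^sub>R ipE x x)"
      using k by (intro nonneg_scaleR R.E.nonneg_ip) simp
    fix z
    have "z * ipE (R x) x * star z = ipE (R (actE z x)) (actE z x)"
      by (simp add: R.act R.E.ip_act_left R.E.ip_act_right mult.assoc)
    moreover have "z * (k *\<^sub>R ipE x x) * star z = k *\<^sub>R ipE (actE z x) (actE z x)"
      by (simp add: R.E.ip_act_left R.E.ip_act_right mult.assoc)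
    moreover have "norm (ipE (R (actE z x)) (actE z x)) \<le> k * (norm (actE z x))\<^sup>2"
      using order_trans[OF R.E.Cauchy_Schwarz mult_right_mono[OF k(2) norm_ge_zero], of "actE z x" "actE z x"]
      by (simp add: power2_eq_square mult.assoc)
    ultimately show "norm (z * ipE (R x) x * star z) \<le> norm (z * (k *\<^sub>R ipE x x) * star z)"
      using k(1) by (simp add: R.E.norm_ip_self)
  qed
  then show thesis
    using that k(1) by blast
qed

section \<open>Combining two frames\<close>

lemma g_family_combination:
  assumes H: "hilbert_module actH ipH" and K: "hilbert_module actK ipK"
    and sub: "\<And>\<xi>. \<xi> \<in> space M \<Longrightarrow> closed_submodule actK (Hs \<xi>)"
    and \<Upsilon>: "g_family M ipH Hs ipK \<Upsilon>" and \<Phi>: "g_family M ipH Hs ipK \<Phi>"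
    and \<Theta>1: "adjointable actH ipH actK ipK \<Theta>1 \<Theta>1'" and \<Theta>2: "adjointable actH ipH actK ipK \<Theta>2 \<Theta>2'"
  shows "g_family M ipK Hs ipK (\<lambda>\<xi> x. \<alpha>1 *\<^sub>R \<Upsilon> \<xi> (\<Theta>1' x) + \<alpha>2 *\<^sub>R \<Phi> \<xi> (\<Theta>2' x))"
proof -
  interpret H: hilbert_module actH ipH by fact
  interpret K: hilbert_module actK ipK by fact
  interpret \<Theta>1: adjointable actK ipK actH ipH \<Theta>1' \<Theta>1
    using \<Theta>1 by (rule adjointable.adjointable_adjoint)
  interpret \<Theta>2: adjointable actK ipK actH ipH \<Theta>2' \<Theta>2
    using \<Theta>2 by (rule adjointable.adjointable_adjoint)
  have "(\<lambda>x. \<alpha>1 *\<^sub>R \<Upsilon> \<xi> (\<Theta>1' x) + \<alpha>2 *\<^sub>R \<Phi> \<xi> (\<Theta>2' x)) \<in> End_adj UNIV ipK (Hs \<xi>) ipK"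
    if \<xi>: "\<xi> \<in> space M" for \<xi>
  proof -
    obtain S S' where S: "adjoint_pair UNIV ipH (Hs \<xi>) ipK (\<Upsilon> \<xi>) S"
        and S': "adjoint_pair UNIV ipH (Hs \<xi>) ipK (\<Phi> \<xi>) S'"
      using \<Upsilon> \<Phi> \<xi> unfolding g_family_def End_adj_def by blast
    have "subspace (Hs \<xi>)"
      using sub[OF \<xi>] by (simp add: closed_submodule_def)
    then have "adjoint_pair UNIV ipK (Hs \<xi>) ipK (\<lambda>x. \<alpha>1 *\<^sub>R \<Upsilon> \<xi> (\<Theta>1' x) + \<alpha>2 *\<^sub>R \<Phi> \<xi> (\<Theta>2' x))
        (\<lambda>y. \<alpha>1 *\<^sub>R \<Theta>1 (S y) + \<alpha>2 *\<^sub>R \<Theta>2 (S' y))"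
      using S S'
      by (simp add: adjoint_pair_def subspace_add subspace_scale K.ip_add_left K.ip_scaleR_left
          K.ip_add_right K.ip_scaleR_right \<Theta>1.ip_adjoint \<Theta>2.ip_adjoint)
    then show ?thesis
      by (auto simp: End_adj_def)
  qed
  then show ?thesis
    using \<Upsilon> \<Phi> by (simp add: g_family_def strongly_measurable_add strongly_measurable_scaleR)
qed

text \<open>Moving the adjoint across in the weak definition supplies both the integrability and the
  integral of the mixed inner products.\<close>

lemma synthesis_has_strong_integral:
  assumes E: "hilbert_module actE ipE" and K: "hilbert_module actK ipK"
    and \<Upsilon>: "g_family M ipE Hs ipK \<Upsilon>" and T: "synthesis_operator M ipE Hs ipK \<Upsilon> T"
    and F: "F \<in> direct_sum M Hs ipK"
  shows "has_strong_integral M (\<lambda>\<xi>. ipK (F \<xi>) (\<Upsilon> \<xi> g)) (ipE (T F) g)"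
proof -
  interpret E: hilbert_module actE ipE by fact
  interpret K: hilbert_module actK ipK by fact
  have "ipE (adj ipE ipK (\<Upsilon> \<xi>) (F \<xi>)) g = ipK (F \<xi>) (\<Upsilon> \<xi> g)" if \<xi>: "\<xi> \<in> space M" for \<xi>
  proof -
    have F\<xi>: "F \<xi> \<in> Hs \<xi>"
      using F \<xi> by (simp add: direct_sum_def)
    obtain S where S: "adjoint_pair UNIV ipE (Hs \<xi>) ipK (\<Upsilon> \<xi>) S"
      using \<Upsilon> \<xi> by (auto simp: g_family_def End_adj_def)
    have "adj ipE ipK (\<Upsilon> \<xi>) (F \<xi>) = S (F \<xi>)"
      using E S F\<xi> by (rule adj_eq)
    moreover have "ipK (\<Upsilon> \<xi> g) (F \<xi>) = ipE g (S (F \<xi>))"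
      using S F\<xi> by (simp add: adjoint_pair_def)
    ultimately show ?thesis
      using E.ip_star[of "S (F \<xi>)" g] K.ip_star[of "F \<xi>" "\<Upsilon> \<xi> g"] by (simp only:)
  qed
  then have "has_strong_integral M (\<lambda>\<xi>. ipE (adj ipE ipK (\<Upsilon> \<xi>) (F \<xi>)) g) (ipE (T F) g)
      \<longleftrightarrow> has_strong_integral M (\<lambda>\<xi>. ipK (F \<xi>) (\<Upsilon> \<xi> g)) (ipE (T F) g)"
    by (rule has_strong_integral_cong)
  then show ?thesis
    using T F by (simp add: synthesis_operator_def)
qed

lemma strongly_integrable_has_strong_integral:
  "strongly_integrable M f \<Longrightarrow> has_strong_integral M f (strong_integral M f)"
  unfolding strongly_integrable_def using strong_integral_eqI by metis

lemma cKg_frameI: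
  assumes "hilbert_module actE ipE" and "g_family M ipE Hs ipK \<Upsilon>" and "A > 0"
    and int: "\<And>h. has_strong_integral M (\<lambda>\<xi>. ipK (\<Upsilon> \<xi> h) (\<Upsilon> \<xi> h)) (I h)"
    and lower: "\<And>h. A *\<^sub>R ipE (adj ipE ipE K h) (adj ipE ipE K h) \<preceq> I h"
    and upper: "\<And>h. I h \<preceq> B *\<^sub>R ipE h h"
  shows "cKg_frame M ipE K Hs ipK \<Upsilon>"
proof -
  interpret hilbert_module actE ipE by fact
  \<comment> \<open>The frame definition asks for \<open>A \<le> B\<close>, so the upper constant is
    enlarged.\<close>
  have "I h \<preceq> max A B *\<^sub>R ipE h h" for h
    using upper[of h] cstar_le_scaleR_left_mono[OF nonneg_ip[of h], of B "max A B"]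
    by (auto intro: cstar_le_trans)
  then show ?thesis
    unfolding cKg_frame_def using assms strong_integral_eqI[OF int]
    by (intro conjI exI[of _ A] exI[of _ "max A B"]) (auto simp: strongly_integrable_def)
qed

text \<open>By the parallelogram law the gap is \<open>ip (x - y) (x - y)\<close>.\<close>

lemma (in hilbert_module) ip_add_le:
  "ip (x + y) (x + y) \<preceq> 2 *\<^sub>R (ip x x + ip y y)"
proof -
  have "2 *\<^sub>R (ip x x + ip y y) - ip (x + y) (x + y) = ip (x - y) (x - y)"
    by (simp add: ip_add_left ip_add_right ip_diff_left ip_diff_right scaleR_2)
  then show ?thesis
    using nonneg_ip[of "x - y"] by (simp add: cstar_le_iff_nonneg)
qed

text \<open>Applied to the identity in place of \<open>C\<close>, with \<open>S\<close> the range of \<open>K1\<close>,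
  \<open>norm_adjoint_le_if_range\<close> bounds \<open>\<parallel>y\<parallel>\<close> by a multiple of \<open>\<parallel>K1\<^sup>* y\<parallel>\<close> on that range.\<close>

lemma ip_adjoint_le_if_ranges:
  assumes K1: "adjointable actH ipH actH ipH K1 K1'" and K2: "adjointable actK ipK actK ipK K2 K2'"
    and W: "adjointable actH ipH actK ipK W W'"
    and closed: "closed (range K1)"
    and incl: "range K2 \<subseteq> range W" "range W' \<subseteq> range K1"
  obtains k where "k > 0" "\<And>x. ipK (K2' x) (K2' x) \<preceq> k *\<^sub>R ipH (K1' (W' x)) (K1' (W' x))"
proof -
  interpret K1: adjointable actH ipH actH ipH K1 K1' by fact
  have id: "adjointable actH ipH actH ipH (\<lambda>x. x) (\<lambda>x. x)"
    by unfold_locales simp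
  have "subspace (range K1)"
    using linear_subspace_image[OF K1.linear subspace_UNIV] .
  then obtain c where c: "c > 0" "\<And>y. y \<in> range K1 \<Longrightarrow> norm y \<le> c * norm (K1' y)"
    using norm_adjoint_le_if_range[OF id K1 closed] by auto
  obtain d where d: "d > 0" "\<And>y. norm (K2' y) \<le> d * norm (W' y)"
    using norm_adjoint_le_if_range[OF K2 W closed_UNIV subspace_UNIV incl(1)] by auto
  have "norm (K2' y) \<le> (d * c) * norm (K1' (W' y))" for y
  proof -
    have "d * norm (W' y) \<le> d * (c * norm (K1' (W' y)))"
      using c(2)[of "W' y"] incl(2) d(1) by (intro mult_left_mono) auto
    then show ?thesis
      using d(2)[of y] by (simp add: mult.assoc)
  qed
  then have "ipK (K2' x) (K2' x) \<preceq> (d * c)\<^sup>2 *\<^sub>R ipH (K1' (W' x)) (K1' (W' x))" for x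
    using adjointable.adjointable_adjoint[OF K2]
      adjointable_comp[OF adjointable.adjointable_adjoint[OF W] adjointable.adjointable_adjoint[OF K1]]
    by (rule ip_le_of_norm_le[rotated 2])
  then show thesis
    using that[of "(d * c)\<^sup>2"] c d by simp
qed

theorem theorem3p3:
  fixes actH :: "'a::cstar_algebra_1 \<Rightarrow> 'h::banach \<Rightarrow> 'h" and ipH :: "'h \<Rightarrow> 'h \<Rightarrow> 'a"
    and actK :: "'a \<Rightarrow> 'k::banach \<Rightarrow> 'k" and ipK :: "'k \<Rightarrow> 'k \<Rightarrow> 'a"
    and M :: "'w measure" and Hs :: "'w \<Rightarrow> 'k set"
    and \<Upsilon> \<Phi> :: "'w \<Rightarrow> 'h \<Rightarrow> 'k"
    and K1 :: "'h \<Rightarrow> 'h" and K2 :: "'k \<Rightarrow> 'k"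
    and \<Theta>1 \<Theta>2 P Q :: "'h \<Rightarrow> 'k"
    and T\<Upsilon> T\<Phi> :: "('w \<Rightarrow> 'k) \<Rightarrow> 'h"
    and \<alpha>1 \<alpha>2 :: real
  assumes "hilbert_module actH ipH" and "hilbert_module actK ipK"
    and "\<And>\<xi>. \<xi> \<in> space M \<Longrightarrow> closed_submodule actK (Hs \<xi>)"
    and "K1 \<in> End_adj UNIV ipH UNIV ipH" and "closed (range K1)"
    and "cKg_frame M ipH K1 Hs ipK \<Upsilon>" and "cKg_frame M ipH K1 Hs ipK \<Phi>"
    and "synthesis_operator M ipH Hs ipK \<Upsilon> T\<Upsilon>" and "synthesis_operator M ipH Hs ipK \<Phi> T\<Phi>"
    and "K2 \<in> End_adj UNIV ipK UNIV ipK"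
    and "\<Theta>1 \<in> End_adj UNIV ipH UNIV ipK" and "\<Theta>2 \<in> End_adj UNIV ipH UNIV ipK"
    and "positive_op ipK
           (\<lambda>x. \<Theta>1 (T\<Upsilon> (analysis \<Phi> (adj ipH ipK \<Theta>2 x))) + \<Theta>2 (T\<Phi> (analysis \<Upsilon> (adj ipH ipK \<Theta>1 x))))"
    and "\<alpha>1 > 0" and "\<alpha>2 > 0"
    and "P = (\<lambda>x. \<alpha>1 *\<^sub>R \<Theta>1 x + \<alpha>2 *\<^sub>R \<Theta>2 x)"
    and "Q = (\<lambda>x. \<alpha>1 *\<^sub>R \<Theta>1 x - \<alpha>2 *\<^sub>R \<Theta>2 x)"
    and "(range K2 \<subseteq> range P \<and> range (adj ipH ipK P) \<subseteq> range K1) \<or>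
         (range (adj ipH ipK Q) \<subseteq> range K1 \<and> range K2 \<subseteq> range Q \<and>
          orthogonally_complemented ipH (closure (range (adj ipH ipK Q))))"
  shows "cKg_frame M ipK K2 Hs ipK
           (\<lambda>\<xi> x. \<alpha>1 *\<^sub>R \<Upsilon> \<xi> (adj ipH ipK \<Theta>1 x) + \<alpha>2 *\<^sub>R \<Phi> \<xi> (adj ipH ipK \<Theta>2 x))"
proof -
  note HM = assms(1,2)
  interpret H: hilbert_module actH ipH by fact
  interpret K: hilbert_module actK ipK by fact
  define u v where "u = adj ipH ipK \<Theta>1" and "v = adj ipH ipK \<Theta>2"
  define R where "R x = \<Theta>1 (T\<Upsilon> (analysis \<Phi> (v x))) + \<Theta>2 (T\<Phi> (analysis \<Upsilon> (u x)))" for x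
  define K1' K2' where "K1' = adj ipH ipH K1" and "K2' = adj ipK ipK K2"
  have \<Theta>1: "adjointable actH ipH actK ipK \<Theta>1 u" and \<Theta>2: "adjointable actH ipH actK ipK \<Theta>2 v"
    unfolding u_def v_def using HM assms by (auto intro: adjointable_if_End_adj)
  have K1: "adjointable actH ipH actH ipH K1 K1'" and K2: "adjointable actK ipK actK ipK K2 K2'"
    unfolding K1'_def K2'_def using HM assms by (auto intro: adjointable_if_End_adj)
  interpret \<Theta>1: adjointable actH ipH actK ipK \<Theta>1 u by fact
  interpret \<Theta>2: adjointable actH ipH actK ipK \<Theta>2 v by fact
  interpret u: adjointable actK ipK actH ipH u \<Theta>1 by (rule \<Theta>1.adjointable_adjoint)
  interpret v: adjointable actK ipK actH ipH v \<Theta>2 by (rule \<Theta>2.adjointable_adjoint)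
  interpret K1': adjointable actH ipH actH ipH K1' K1
    using K1 by (rule adjointable.adjointable_adjoint)
  have R_pos: "nonneg (ipK (R x) x)" and "R \<in> End_adj UNIV ipK UNIV ipK" for x
    using assms(13) unfolding positive_op_def R_def u_def v_def
    by (simp_all add: cstar_pos_iff_nonneg)
  then have R: "adjointable actK ipK actK ipK R (adj ipK ipK R)"
    using HM by (intro adjointable_if_End_adj)

  \<comment> \<open>The given frames and the integral of the combination\<close>
  have fam: "g_family M ipH Hs ipK \<Upsilon>" "g_family M ipH Hs ipK \<Phi>"
    using assms(6,7) by (simp_all add: cKg_frame_def)
  define I1 I2 where "I1 h = strong_integral M (\<lambda>\<xi>. ipK (\<Upsilon> \<xi> h) (\<Upsilon> \<xi> h))"
    and "I2 h = strong_integral M (\<lambda>\<xi>. ipK (\<Phi> \<xi> h) (\<Phi> \<xi> h))" for h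
  obtain A1 B1 where \<Upsilon>: "0 < A1" "A1 \<le> B1"
      "\<And>h. strongly_integrable M (\<lambda>\<xi>. ipK (\<Upsilon> \<xi> h) (\<Upsilon> \<xi> h))"
      "\<And>h. A1 *\<^sub>R ipH (K1' h) (K1' h) \<preceq> I1 h" "\<And>h. I1 h \<preceq> B1 *\<^sub>R ipH h h"
    using assms(6) unfolding cKg_frame_def I1_def K1'_def by blast
  obtain A2 B2 where \<Phi>: "0 < A2" "A2 \<le> B2"
      "\<And>h. strongly_integrable M (\<lambda>\<xi>. ipK (\<Phi> \<xi> h) (\<Phi> \<xi> h))"
      "\<And>h. A2 *\<^sub>R ipH (K1' h) (K1' h) \<preceq> I2 h" "\<And>h. I2 h \<preceq> B2 *\<^sub>R ipH h h"
    using assms(7) unfolding cKg_frame_def I2_def K1'_def by blast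
  have ds: "analysis \<Upsilon> h \<in> direct_sum M Hs ipK" "analysis \<Phi> h \<in> direct_sum M Hs ipK" for h
    using adjoint_pair_synthesis_analysis[OF HM assms(6,8)]
      adjoint_pair_synthesis_analysis[OF HM assms(7,9)] by (simp_all add: adjoint_pair_def)

  define G where "G \<xi> x = \<alpha>1 *\<^sub>R \<Upsilon> \<xi> (u x) + \<alpha>2 *\<^sub>R \<Phi> \<xi> (v x)" for \<xi> x
  define J where "J x = \<alpha>1\<^sup>2 *\<^sub>R I1 (u x) + \<alpha>2\<^sup>2 *\<^sub>R I2 (v x) + (\<alpha>1 * \<alpha>2) *\<^sub>R ipK (R x) x" for x
  have J: "has_strong_integral M (\<lambda>\<xi>. ipK (G \<xi> x) (G \<xi> x)) (J x)" for x
  proof -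
    \<comment> \<open>The two cross terms: each comes from one synthesis operator applied to the
      analysis of the other family.\<close>
    have "has_strong_integral M (\<lambda>\<xi>. ipK (\<Phi> \<xi> (v x)) (\<Upsilon> \<xi> (u x)) + ipK (\<Upsilon> \<xi> (u x)) (\<Phi> \<xi> (v x)))
        (ipH (T\<Upsilon> (analysis \<Phi> (v x))) (u x) + ipH (T\<Phi> (analysis \<Upsilon> (u x))) (v x))"
      using synthesis_has_strong_integral[OF HM fam(1) assms(8) ds(2)]
        synthesis_has_strong_integral[OF HM fam(2) assms(9) ds(1)]
      unfolding analysis_def by (rule has_strong_integral_add)
    also have "ipH (T\<Upsilon> (analysis \<Phi> (v x))) (u x) + ipH (T\<Phi> (analysis \<Upsilon> (u x))) (v x) = ipK (R x) x"
      by (simp add: R_def K.ip_add_left \<Theta>1.ip_adjoint \<Theta>2.ip_adjoint)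
    finally have "has_strong_integral M
       (\<lambda>\<xi>. \<alpha>1\<^sup>2 *\<^sub>R ipK (\<Upsilon> \<xi> (u x)) (\<Upsilon> \<xi> (u x)) + \<alpha>2\<^sup>2 *\<^sub>R ipK (\<Phi> \<xi> (v x)) (\<Phi> \<xi> (v x)) +
         (\<alpha>1 * \<alpha>2) *\<^sub>R (ipK (\<Phi> \<xi> (v x)) (\<Upsilon> \<xi> (u x)) + ipK (\<Upsilon> \<xi> (u x)) (\<Phi> \<xi> (v x)))) (J x)"
      unfolding J_def I1_def I2_def
      by (intro has_strong_integral_add has_strong_integral_scaleR
          strongly_integrable_has_strong_integral \<Upsilon>(3) \<Phi>(3))
    then show ?thesis
      by (simp add: G_def K.ip_add_left K.ip_add_right K.ip_scaleR_left K.ip_scaleR_right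
          power2_eq_square algebra_simps)
  qed

  \<comment> \<open>Both conditions are treated at once: \<alpha> is \<alpha>2 for \<open>P\<close>
    and its negative for \<open>Q\<close>, and the final constants see only its square.\<close>
  obtain \<alpha> W where \<alpha>: "\<alpha>\<^sup>2 = \<alpha>2\<^sup>2" and W: "W = (\<lambda>x. \<alpha>1 *\<^sub>R \<Theta>1 x + \<alpha> *\<^sub>R \<Theta>2 x)"
      and incl: "range K2 \<subseteq> range W" "range (adj ipH ipK W) \<subseteq> range K1"
    using assms(16-18) by (elim disjE) (auto intro: that[of \<alpha>2 P] that[of "- \<alpha>2" Q])
  have W': "adjointable actH ipH actK ipK W (\<lambda>y. \<alpha>1 *\<^sub>R u y + \<alpha> *\<^sub>R v y)"
    unfolding W using \<Theta>1 \<Theta>2 by (rule adjointable_combination)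
  obtain k where k: "k > 0"
      "\<And>x. ipK (K2' x) (K2' x) \<preceq> k *\<^sub>R ipH (K1' (\<alpha>1 *\<^sub>R u x + \<alpha> *\<^sub>R v x)) (K1' (\<alpha>1 *\<^sub>R u x + \<alpha> *\<^sub>R v x))"
    using ip_adjoint_le_if_ranges[OF K1 K2 W' assms(5) incl(1)] incl(2)
    unfolding adjointable.adj_eq_adjoint[OF W'] by blast

  \<comment> \<open>The lower frame bound\<close>
  define A where "A = min A1 A2"
  have A: "0 < A" "A \<le> A1" "A \<le> A2"
    using \<Upsilon>(1) \<Phi>(1) by (auto simp: A_def)
  \<comment> \<open>Dividing by \<open>k\<close> cancels the constant of the range comparison; the
    \<open>2\<close> absorbs the factor in \<open>ip_add_le\<close>.\<close>
  have lower: "(A / (2 * k)) *\<^sub>R ipK (K2' x) (K2' x) \<preceq> J x" for x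
  proof -
    let ?a = "K1' (u x)" and ?b = "K1' (v x)"
    have "(A / (2 * k)) *\<^sub>R ipK (K2' x) (K2' x) \<preceq> (A / (2 * k)) *\<^sub>R k *\<^sub>R
        ipH (K1' (\<alpha>1 *\<^sub>R u x + \<alpha> *\<^sub>R v x)) (K1' (\<alpha>1 *\<^sub>R u x + \<alpha> *\<^sub>R v x))"
      using A k by (intro cstar_le_scaleR_mono k(2)) simp
    also have "\<dots> = (A / 2) *\<^sub>R ipH (\<alpha>1 *\<^sub>R ?a + \<alpha> *\<^sub>R ?b) (\<alpha>1 *\<^sub>R ?a + \<alpha> *\<^sub>R ?b)"
      using k(1) K1'.linear by (simp add: linear_add linear_scale)
    also have "\<dots> \<preceq> (A / 2) *\<^sub>R 2 *\<^sub>R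
        (ipH (\<alpha>1 *\<^sub>R ?a) (\<alpha>1 *\<^sub>R ?a) + ipH (\<alpha> *\<^sub>R ?b) (\<alpha> *\<^sub>R ?b))"
      using A by (intro cstar_le_scaleR_mono H.ip_add_le) simp
    also have "\<dots> = \<alpha>1\<^sup>2 *\<^sub>R A *\<^sub>R ipH ?a ?a + \<alpha>2\<^sup>2 *\<^sub>R A *\<^sub>R ipH ?b ?b"
      by (simp add: H.ip_scaleR_left H.ip_scaleR_right algebra_simps flip: \<alpha> power2_eq_square)
    also have "\<dots> \<preceq> \<alpha>1\<^sup>2 *\<^sub>R I1 (u x) + \<alpha>2\<^sup>2 *\<^sub>R I2 (v x)"
      using A cstar_le_trans[OF cstar_le_scaleR_left_mono[OF H.nonneg_ip A(2)] \<Upsilon>(4)]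
        cstar_le_trans[OF cstar_le_scaleR_left_mono[OF H.nonneg_ip A(3)] \<Phi>(4)]
      by (intro cstar_le_add_mono cstar_le_scaleR_mono) simp_all
    also have "\<dots> \<preceq> J x"
      using nonneg_scaleR[OF R_pos] assms(14,15) by (simp add: J_def cstar_le_iff_nonneg)
    finally show ?thesis .
  qed

  \<comment> \<open>The upper frame bound\<close>
  obtain r where r: "r > 0" "\<And>x. ipK (R x) x \<preceq> r *\<^sub>R ipK x x"
    using ip_form_bounded[OF R R_pos] by blast
  have id: "adjointable actK ipK actK ipK (\<lambda>x. x) (\<lambda>x. x)"
    by unfold_locales simp
  obtain c where c: "\<And>x. norm (u x) \<le> c * norm x"
    using u.bounded by blast
  obtain d where d: "\<And>x. norm (v x) \<le> d * norm x"
    using v.bounded by blast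
  \<comment> \<open>One summand for each part of \<open>J\<close>: the two upper frame bounds
    combined with the bounds of \<open>u\<close> and \<open>v\<close>, and the bound
    \<open>r\<close> of the cross terms.\<close>
  define B where "B = \<alpha>1\<^sup>2 * (B1 * c\<^sup>2) + \<alpha>2\<^sup>2 * (B2 * d\<^sup>2) + \<alpha>1 * \<alpha>2 * r"
  have upper: "J x \<preceq> B *\<^sub>R ipK x x" for x
  proof -
    have "I1 (u x) \<preceq> B1 *\<^sub>R c\<^sup>2 *\<^sub>R ipK x x"
      using cstar_le_scaleR_mono[OF ip_le_of_norm_le[OF u.adjointable_axioms id c], of B1 x] \<Upsilon>
      by (auto intro: cstar_le_trans)
    moreover have "I2 (v x) \<preceq> B2 *\<^sub>R d\<^sup>2 *\<^sub>R ipK x x"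
      using cstar_le_scaleR_mono[OF ip_le_of_norm_le[OF v.adjointable_axioms id d], of B2 x] \<Phi>
      by (auto intro: cstar_le_trans)
    ultimately have "J x \<preceq> \<alpha>1\<^sup>2 *\<^sub>R B1 *\<^sub>R c\<^sup>2 *\<^sub>R ipK x x + \<alpha>2\<^sup>2 *\<^sub>R B2 *\<^sub>R d\<^sup>2 *\<^sub>R ipK x x
        + (\<alpha>1 * \<alpha>2) *\<^sub>R r *\<^sub>R ipK x x"
      unfolding J_def using assms(14,15) r
      by (intro cstar_le_add_mono cstar_le_scaleR_mono) simp_all
    also have "\<dots> = B *\<^sub>R ipK x x"
      by (simp add: B_def scaleR_add_left)
    finally show ?thesis .
  qed

  have "g_family M ipK Hs ipK G"
    unfolding G_def using HM assms(3) fam \<Theta>1 \<Theta>2 by (rule g_family_combination)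
  then have "cKg_frame M ipK K2 Hs ipK G"
    using HM(2) A(1) k(1) J lower upper unfolding K2'_def
    by (intro cKg_frameI[where A="A / (2 * k)" and I=J and B=B]) auto
  then show ?thesis
    by (simp add: G_def[abs_def] u_def v_def)
qed

end
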